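(* Let $\mu$ denote the Möbius function, $\{t\} = t - \lfloor t\rfloor$ the fractional part, and for $X\in\mathbb{N}$ and integrable $f$ let $E_X(f(x)) = \frac{1}{X}\int_0^X f(x)\,dx$. Then $$\sum_{n\neq m}\frac{\mu(n)\mu(m)}{nm}\,E_X\big(\{nx\}\{mx\}\big) = -\frac{9}{2\pi^2} + O\!\left(\frac{1}{X}\right),$$ where the double series over pairs of distinct positive integers $n\neq m$ is understood as $\lim_{N\to\infty}\sum_{\substack{n\neq m\\ n,m\leq N}}\frac{\mu(n)\mu(m)}{nm}E_X(\{nx\}\{mx\})$, and the error term $O(1/X)$ means that the difference between the left-hand side and $-\frac{9}{2\pi^2}$ is bounded in absolute value by $C/X$ for some constant $C$ independent of $X\in\mathbb{N}$.
   Context: $\mu(n)=0$ if $n$ has a repeated prime factor and $\mu(n)=(-1)^{\omega(n)}$ if $n$ is square-free with $\omega(n)$ distinct prime factors. $\lfloor t\rfloor$ is the largest integer $\leq t$. The expected value $E_X$ is taken with $x$ uniformly distributed on $[0,X]$, with $X$ a positive integer. *)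

theory Defs
  imports
    "HOL-Analysis.Analysis"
    "HOL-Computational_Algebra.Computational_Algebra"
begin

(* moebius 0 = 0, since 0 is not squarefree. *)
definition moebius :: "nat \<Rightarrow> real" where
  "moebius n = (if squarefree n then (-1) ^ card (prime_factors n) else 0)"

definition mean_upto :: "nat \<Rightarrow> (real \<Rightarrow> real) \<Rightarrow> real" where
  "mean_upto X f = 1 / real X * integral {0..real X} f"

definition offdiag_sum :: "nat \<Rightarrow> nat \<Rightarrow> real" where
  "offdiag_sum X N =
     (\<Sum>(n, m) \<in> {(n, m). n \<in> {1..N} \<and> m \<in> {1..N} \<and> n \<noteq> m}.
        moebius n * moebius m / (real n * real m) *
        mean_upto X (\<lambda>x. frac (real n * x) * frac (real m * x)))"

end

theory Submission
  imports Defs "HOL-Complex_Analysis.Complex_Analysis" "HOL-Real_Asymp.Real_Asymp"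
begin

text \<open>
  The functions \<open>{nx}\<close> have period 1, so the mean over \<open>[0, X]\<close> is the integral over \<open>[0, 1]\<close>, which equals
  \<open>1/4 + gcd(n,m)\<^sup>2 / (12nm)\<close>; hence the limit does not depend on \<open>X\<close> and the error term is 0. The full
  square of pairs contributes \<open>(\<Sum> \<mu>(n)/n)\<^sup>2 / 4 + (1/12) \<Sum> \<mu>(n)\<mu>(m) gcd(n,m)\<^sup>2/(nm)\<^sup>2\<close>. In the second sum
  the terms for fixed \<open>n > 1\<close> cancel in pairs \<open>m, pm\<close> for a prime \<open>p\<close> dividing \<open>n\<close>, which leaves
  \<open>1/\<zeta>(2) = 6/\<pi>\<^sup>2\<close>. The diagonal contributes \<open>(1/3) \<Sum> \<mu>(n)\<^sup>2/n\<^sup>2 = \<zeta>(2)/(3\<zeta>(4)) = 5/\<pi>\<^sup>2\<close>.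

  The deep ingredient is \<open>\<Sum> \<mu>(n)/n = 0\<close>, which is equivalent to the prime number theorem. It follows from
  Newman's contour argument applied to \<open>1/\<zeta>\<close>, once \<open>\<zeta>\<close> is known not to vanish on the line
  \<open>Re s = 1\<close>.
\<close>

section \<open>Newman's Tauberian theorem\<close>

text \<open>The double series is not absolutely convergent, because the 1/4 in each correlation
  multiplies mu(n) mu(m)/(nm). This is why the truncation to squares matters: it turns that part
  into the square of one partial sum, and only this part needs the prime number theorem. The gcd
  part and the diagonal converge absolutely, so they can be regrouped freely.

  The analysis concerns 1/zeta itself, not log zeta or zeta'/zeta. Its coefficients are bounded by
  1, which is all that Newman's argument asks of the coefficients; its Euler products over finitely
  many primes expand into finite sums; and the pole of zeta becomes the zero of 1/zeta at 1, which
  is the value of the sum of mu(n)/n.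

  The correlations come from writing the fractional part as 1/2 plus a sawtooth of mean 0, whose
  distribution relation under x -> x + j/b removes one frequency at a time.

  The final constant is 6/pi^2/12 - 15/pi^2/3 = (1/2 - 5)/pi^2.\<close>

lemma powr_neg_telescope_le:
  fixes x n :: real
  assumes "x > 0" "n > 0"
  shows "(n + 1) powr (-1 - x) \<le> (n powr (-x) - (n + 1) powr (-x)) / x"
proof -
  have "\<exists>z>n. z < n + 1 \<and> (n + 1) powr (-x) - n powr (-x) = (n + 1 - n) * (- x * z powr (-x - 1))"
    using assms by (intro MVT2) (auto intro!: derivative_eq_intros)
  then obtain z where z: "z > n" "z < n + 1"
    "(n + 1) powr (-x) - n powr (-x) = - x * z powr (-1 - x)"
    by (auto simp: minus_diff_commute)
  have "(n + 1) powr (-1 - x) \<le> z powr (-1 - x)"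
    using z assms by (intro powr_mono2') auto
  hence "x * (n + 1) powr (-1 - x) \<le> n powr (-x) - (n + 1) powr (-x)"
    using z(3) mult_left_mono[of "(n + 1) powr (-1 - x)" "z powr (-1 - x)" x] assms by linarith
  with assms show ?thesis
    by (simp add: field_simps)
qed

text \<open>Comparison with the integral of t^(-1-x), in the form of a telescoping series with terms
  \<open>f k - f (Suc k)\<close>.\<close>

lemma powr_tail_sum:
  fixes x :: real
  assumes "x > 0" "N \<ge> 1"
  shows "summable (\<lambda>k. real (k + Suc N) powr (-1 - x))"
    and "(\<Sum>k. real (k + Suc N) powr (-1 - x)) \<le> real N powr (-x) / x"
proof -
  define f where "f k = real (k + N) powr (-x) / x" for k
  have "f \<longlonglongrightarrow> 0"
    unfolding f_def using assms by real_asymp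
  hence sums: "(\<lambda>k. f k - f (Suc k)) sums (f 0)"
    using telescope_sums'[of f 0] by simp
  have le: "real (k + Suc N) powr (-1 - x) \<le> f k - f (Suc k)" for k
    using powr_neg_telescope_le[of x "real (k + N)"] assms
    by (simp add: f_def diff_divide_distrib add_ac)
  show summ: "summable (\<lambda>k. real (k + Suc N) powr (-1 - x))"
    by (rule summable_comparison_test[OF _ sums_summable[OF sums]]) (use le in auto)
  show "(\<Sum>k. real (k + Suc N) powr (-1 - x)) \<le> real N powr (-x) / x"
    using suminf_le[OF le summ sums_summable[OF sums]] sums
    by (simp add: sums_iff f_def)
qed

text \<open>Comparison with the integral of t^(x-1), which decreases for x \<le> 1 and increases for
  x > 1. In the increasing case the integral up to N only controls the terms below N, so the last
  term is added separately; it is the source of the 1/N in Newman's estimate.\<close>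

lemma sum_powr_le:
  fixes x :: real
  assumes "x > 0"
  shows "(\<Sum>n=1..N. real n powr (x - 1)) \<le> real N powr x / x + real N powr (x - 1)"
proof (cases "x \<le> 1")
  case True
  have "(\<Sum>n=1..N. real n powr (x - 1)) \<le> real N powr x / x"
  proof (induction N)
    case (Suc N)
    have "real (Suc N) powr (x - 1) \<le> (real (Suc N) powr x - real N powr x) / x"
    proof (cases "N = 0")
      case True
      with assms \<open>x \<le> 1\<close> show ?thesis by (simp add: field_simps)
    next
      case False
      have "\<exists>z>real N. z < real (Suc N) \<and> real (Suc N) powr x - real N powr x
              = (real (Suc N) - real N) * (x * z powr (x - 1))"
        using False by (intro MVT2) (auto intro!: derivative_eq_intros)
      then obtain z where z: "z > real N" "z < real (Suc N)"
        "real (Suc N) powr x - real N powr x = x * z powr (x - 1)" by auto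
      have "real (Suc N) powr (x - 1) \<le> z powr (x - 1)"
        using z True False by (intro powr_mono2') auto
      with z assms show ?thesis by (simp add: field_simps)
    qed
    with Suc show ?case by (simp add: diff_divide_distrib)
  qed (use assms in auto)
  moreover have "real N powr (x - 1) \<ge> 0" by simp
  ultimately show ?thesis by linarith
next
  case False
  have "(\<Sum>n<N. real n powr (x - 1)) \<le> real N powr x / x"
  proof (induction N)
    case (Suc N)
    have "real N powr (x - 1) \<le> (real (Suc N) powr x - real N powr x) / x"
    proof (cases "N = 0")
      case True
      with assms show ?thesis by (simp add: field_simps)
    next
      case nz: False
      have "\<exists>z>real N. z < real (Suc N) \<and> real (Suc N) powr x - real N powr x
              = (real (Suc N) - real N) * (x * z powr (x - 1))"
        using nz by (intro MVT2) (auto intro!: derivative_eq_intros)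
      then obtain z where z: "z > real N" "z < real (Suc N)"
        "real (Suc N) powr x - real N powr x = x * z powr (x - 1)" by auto
      have "real N powr (x - 1) \<le> z powr (x - 1)"
        using z False by (intro powr_mono2) auto
      with z assms show ?thesis by (simp add: field_simps)
    qed
    with Suc show ?case by (simp add: diff_divide_distrib)
  qed (use assms in auto)
  \<comment> \<open>Index 0 may be added since \<open>0 powr (x - 1) = 0\<close>.\<close>
  moreover have "(\<Sum>n=1..N. real n powr (x - 1)) = (\<Sum>n<Suc N. real n powr (x - 1))"
    by (intro sum.mono_neutral_left) auto
  ultimately show ?thesis by simp
qed

section \<open>Contours around 0 and integrals of N^z over segments\<close>

text \<open>The primitive \<open>Ln (-z)\<close> of \<open>1/z\<close> has its branch cut on the right, so it handles paths through the left half plane.\<close>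

lemma contour_integral_inverse_left:
  assumes "valid_path g" "path_image g \<inter> \<real>\<^sub>\<ge>\<^sub>0 = {}" "R > 0"
    "pathstart g = \<i> * of_real R" "pathfinish g = - \<i> * of_real R"
  shows "((\<lambda>z. 1 / z) has_contour_integral (\<i> * pi)) g"
proof -
  have "((\<lambda>z. 1 / z) has_contour_integral (Ln (- pathfinish g) - Ln (- pathstart g))) g"
  proof (rule contour_integral_primitive[where S = "- \<real>\<^sub>\<ge>\<^sub>0"])
    fix z :: complex assume z: "z \<in> - \<real>\<^sub>\<ge>\<^sub>0"
    hence "-z \<notin> \<real>\<^sub>\<le>\<^sub>0" by (auto simp: complex_nonneg_Reals_iff complex_nonpos_Reals_iff)
    thus "((\<lambda>z. Ln (- z)) has_field_derivative 1 / z) (at z within - \<real>\<^sub>\<ge>\<^sub>0)"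
      using z by (auto intro!: derivative_eq_intros simp: field_simps)
  qed (use assms in auto)
  moreover have "Ln (\<i> * of_real R) = of_real (ln R) + \<i> * (pi / 2)"
    using assms(3) Ln_times_of_real[of R \<i>] by (simp add: mult.commute Ln_of_real)
  moreover have "Ln (- (\<i> * of_real R)) = of_real (ln R) - \<i> * (pi / 2)"
    using assms(3) Ln_times_of_real[of R "-\<i>"] by (simp add: mult.commute Ln_of_real)
  ultimately show ?thesis using assms by simp
qed

lemma contour_integral_inverse_right:
  assumes "valid_path g" "path_image g \<inter> \<real>\<^sub>\<le>\<^sub>0 = {}" "R > 0"
    "pathstart g = - \<i> * of_real R" "pathfinish g = \<i> * of_real R"
  shows "((\<lambda>z. 1 / z) has_contour_integral (\<i> * pi)) g"
proof -
  have "((\<lambda>z. 1 / z) has_contour_integral (Ln (pathfinish g) - Ln (pathstart g))) g"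
  proof (rule contour_integral_primitive[where S = "- \<real>\<^sub>\<le>\<^sub>0"])
    fix z :: complex assume z: "z \<in> - \<real>\<^sub>\<le>\<^sub>0"
    thus "(Ln has_field_derivative 1 / z) (at z within - \<real>\<^sub>\<le>\<^sub>0)"
      by (auto intro!: derivative_eq_intros simp: field_simps)
  qed (use assms in auto)
  moreover have "Ln (\<i> * of_real R) = of_real (ln R) + \<i> * (pi / 2)"
    using assms(3) Ln_times_of_real[of R \<i>] by (simp add: mult.commute Ln_of_real)
  moreover have "Ln (- (\<i> * of_real R)) = of_real (ln R) - \<i> * (pi / 2)"
    using assms(3) Ln_times_of_real[of R "-\<i>"] by (simp add: mult.commute Ln_of_real)
  ultimately show ?thesis using assms by simp
qed

text \<open>Each half contributes pi i to the integral of 1/z. The left half is left arbitrary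
  because the same right semicircle is closed up once by a semicircle and once by a polygonal
  path.\<close>

lemma winding_number_join_halves:
  assumes "valid_path g" "path_image g \<inter> \<real>\<^sub>\<le>\<^sub>0 = {}" "R > 0"
    "pathstart g = - \<i> * of_real R" "pathfinish g = \<i> * of_real R"
    "valid_path h" "path_image h \<inter> \<real>\<^sub>\<ge>\<^sub>0 = {}"
    "pathstart h = \<i> * of_real R" "pathfinish h = - \<i> * of_real R"
  shows "winding_number (g +++ h) 0 = 1"
proof -
  have "((\<lambda>z. 1 / z) has_contour_integral (\<i> * pi + \<i> * pi)) (g +++ h)"
    by (intro has_contour_integral_join contour_integral_inverse_left[of _ R]
          contour_integral_inverse_right[of _ R]) (use assms in auto)
  moreover have "0 \<notin> path_image (g +++ h)"
    using assms by (auto simp: path_image_join)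
  ultimately show ?thesis
    using assms by (subst winding_number_valid_path) (auto simp: contour_integral_unique)
qed

text \<open>Dominated convergence: |N^z| = N^(Re z) is at most 1 and tends to 0 wherever Re z < 0.
  Only interior points are required to be on the left, since the segments used below may end on the
  imaginary axis.\<close>

lemma contour_integral_linepath_decay:
  fixes Q :: "complex \<Rightarrow> complex"
  assumes cont: "continuous_on (closed_segment a b) Q"
    and neg: "\<And>t. t \<in> {0<..<1} \<Longrightarrow> Re (linepath a b t) < 0"
  shows "(\<lambda>N::nat. contour_integral (linepath a b) (\<lambda>z. Q z * of_nat N powr z)) \<longlonglongrightarrow> 0"
proof -
  have contl: "continuous_on {0..1} (\<lambda>t. Q (linepath a b t))"
    by (rule continuous_on_compose2[OF cont]) (auto intro!: continuous_intros simp: linepath_in_path)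
  have "compact ((\<lambda>t. Q (linepath a b t)) ` {0..1})"
    by (intro compact_continuous_image contl) auto
  then obtain M where M: "\<And>t. t \<in> {0..1} \<Longrightarrow> norm (Q (linepath a b t)) \<le> M"
    by (metis compact_imp_bounded bounded_iff image_eqI)
  have M0: "M \<ge> 0" using order_trans[OF norm_ge_zero M[of 0]] by simp
  define f where "f N t = Q (linepath a b t) * of_nat N powr (linepath a b t) * (b - a)" for N :: nat and t
  have norm_powr: "norm (of_nat N powr (linepath a b t)) = real N powr Re (linepath a b t)" for N :: nat and t
    by (cases "N = 0") (auto simp: norm_powr_real_powr)
  \<comment> \<open>Shifting to \<open>Suc N\<close> keeps the base of the power nonzero, which
    continuity in the exponent relies on.\<close>
  have "(\<lambda>N. integral {0<..<1} (f (Suc N))) \<longlonglongrightarrow> integral {0<..<1::real} (\<lambda>_. 0 :: complex)"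
  proof (rule dominated_convergence(2)[where f = "\<lambda>N. f (Suc N)" and h = "\<lambda>_. M * norm (b - a)"])
    fix N :: nat
    have "continuous_on {0..1} (f (Suc N))"
      unfolding f_def using of_nat_neq_0[of N, where ?'a = complex]
      by (intro continuous_intros contl) (auto simp del: of_nat_Suc)
    hence "f (Suc N) integrable_on {0..1}"
      by (rule integrable_continuous_real)
    thus "f (Suc N) integrable_on {0<..<1}"
      by (simp add: integrable_on_open_interval_real)
  next
    show "(\<lambda>t. M * norm (b - a)) integrable_on {0<..<1::real}"
      unfolding integrable_on_open_interval_real by (rule integrable_const_ivl)
  next
    fix N :: nat and t :: real assume t: "t \<in> {0<..<1}"
    have "real (Suc N) powr Re (linepath a b t) \<le> real (Suc N) powr 0"
      using neg[OF t] by (intro powr_mono) auto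
    hence "norm (Q (linepath a b t)) * real (Suc N) powr Re (linepath a b t) \<le> M * 1"
      using t M[of t] M0 by (intro mult_mono) auto
    thus "norm (f (Suc N) t) \<le> M * norm (b - a)"
      unfolding f_def norm_mult norm_powr by (intro mult_right_mono) auto
  next
    fix t :: real assume t: "t \<in> {0<..<1}"
    define x where "x = Re (linepath a b t)"
    have "x < 0" using neg[OF t] by (simp add: x_def)
    hence "(\<lambda>N. norm (Q (linepath a b t)) * real (Suc N) powr x * norm (b - a)) \<longlonglongrightarrow> 0"
      by real_asymp
    thus "(\<lambda>N. f (Suc N) t) \<longlonglongrightarrow> 0"
      by (intro tendsto_norm_zero_cancel[of "\<lambda>N. f (Suc N) t"])
         (simp only: f_def norm_mult norm_powr x_def)
  qed
  hence "(\<lambda>N. integral {0..1} (f (Suc N))) \<longlonglongrightarrow> 0"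
    by (simp add: integral_open_interval_real)
  hence "(\<lambda>N. integral {0..1} (f N)) \<longlonglongrightarrow> 0"
    by (rule LIMSEQ_imp_Suc)
  thus ?thesis
    by (simp add: f_def[abs_def] contour_integral_integral mult.assoc)
qed

lemma semicircle_right_image:
  assumes "R > 0" "z \<in> path_image (part_circlepath 0 R (-(pi / 2)) (pi / 2))"
  shows "norm z = R" "Re z \<ge> 0"
proof -
  have *: "closed_segment (-(pi / 2)) (pi / 2) = {-(pi / 2)..pi / 2}"
    by (auto simp: closed_segment_eq_real_ivl)
  obtain x where x: "-(pi / 2) \<le> x" "x \<le> pi / 2" "z = R * cis x"
    using assms(2) unfolding path_image_part_circlepath' * by auto
  thus "norm z = R" "Re z \<ge> 0"
    using assms(1) by (auto simp: norm_mult intro!: mult_nonneg_nonneg cos_ge_zero)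
qed

lemma semicircle_left_image:
  assumes "R > 0" "z \<in> path_image (part_circlepath 0 R (pi / 2) (pi + pi / 2))"
  shows "norm z = R" "Re z \<le> 0"
proof -
  have *: "closed_segment (pi / 2) (pi + pi / 2) = {pi / 2..pi + pi / 2}"
    by (auto simp: closed_segment_eq_real_ivl)
  obtain x where x: "pi / 2 \<le> x" "x \<le> pi + pi / 2" "z = R * cis x"
    using assms(2) unfolding path_image_part_circlepath' * by auto
  have "cos (x - pi) \<ge> 0" using x by (intro cos_ge_zero) auto
  thus "norm z = R" "Re z \<le> 0"
    using assms(1) x by (auto simp: norm_mult mult_nonneg_nonpos cos_diff)
qed

text \<open>The bounds on the semicircles divide by Re z; this identifies the two endpoints as the
  only points to be excepted.\<close>

lemma norm_eq_Re_0_imp: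
  assumes "norm z = R" "Re z = 0"
  shows "z \<in> {\<i> * of_real R, - \<i> * of_real R}"
proof -
  have "\<bar>Im z\<bar> = R" using assms by (simp add: cmod_eq_Im)
  thus ?thesis using assms(2) by (auto simp: complex_eq_iff abs_if split: if_splits)
qed

text \<open>On the circle R^2 = z * cnj z, so the quotient is (cnj z + z) / R^2.\<close>

lemma Newman_kernel_on_circle:
  assumes "norm z = R" "R > 0"
  shows "(1 + z\<^sup>2 / of_real (R\<^sup>2)) / z = of_real (2 * Re z / R\<^sup>2)"
proof -
  have "z * cnj z = of_real (R\<^sup>2)" 
    using assms by (simp add: complex_norm_square[symmetric])
  moreover have "z + cnj z = of_real (2 * Re z)" by (rule complex_add_cnj)
  ultimately have "of_real (R\<^sup>2) + z\<^sup>2 = z * of_real (2 * Re z)"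
    by (metis add.commute distrib_left power2_eq_square)
  moreover have "z \<noteq> 0" "of_real (R\<^sup>2) \<noteq> (0::complex)" using assms by auto
  ultimately show ?thesis
    by (simp add: divide_simps mult_ac del: of_real_power)
qed

lemma norm_nat_powr: "norm (of_nat n powr (z :: complex)) = real n powr Re z"
  by (cases "n = 0") (auto simp: norm_powr_real_powr)

section \<open>Newman's contour argument for Dirichlet series with coefficients bounded by 1\<close>

context
  fixes a :: "nat \<Rightarrow> complex"
  assumes norm_a: "\<And>n. norm (a n) \<le> 1"
begin

lemma dirichlet_tail_bound:
  assumes "(\<lambda>n. a n * of_nat n powr (-(1 + z))) sums h" "Re z > 0" "N \<ge> 1"
  shows "norm (h - (\<Sum>n=1..N. a n * of_nat n powr (-(1 + z)))) \<le> real N powr (-Re z) / Re z"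
proof -
  define f where "f n = a n * of_nat n powr (-(1 + z))" for n
  have "(\<lambda>k. f (k + Suc N)) sums (h - (\<Sum>n<Suc N. f n))"
    using assms(1) unfolding f_def by (rule sums_split_initial_segment)
  \<comment> \<open>The term at 0 vanishes, again because \<open>0 powr z = 0\<close>.\<close>
  moreover have "(\<Sum>n<Suc N. f n) = (\<Sum>n=1..N. f n)"
    by (intro sum.mono_neutral_right) (auto simp: f_def)
  ultimately have "(\<lambda>k. f (k + Suc N)) sums (h - (\<Sum>n=1..N. f n))" by simp
  moreover have "norm (f (k + Suc N)) \<le> real (k + Suc N) powr (-1 - Re z)" for k
  proof -
    have "norm (f (k + Suc N)) = norm (a (k + Suc N)) * real (k + Suc N) powr (-1 - Re z)"
      unfolding f_def norm_mult norm_nat_powr by simp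
    also have "\<dots> \<le> 1 * real (k + Suc N) powr (-1 - Re z)"
      by (intro mult_right_mono norm_a) auto
    finally show ?thesis by simp
  qed
  ultimately have "norm (h - (\<Sum>n=1..N. f n)) \<le> (\<Sum>k. real (k + Suc N) powr (-1 - Re z))"
    by (rule norm_sums_le[OF _ summable_sums[OF powr_tail_sum(1)[OF assms(2,3)]]])
  with powr_tail_sum(2)[OF assms(2,3)] show ?thesis by (simp add: f_def)
qed

lemma dirichlet_partial_sum_bound:
  assumes "Re z < 0"
  shows "norm (\<Sum>n=1..N. a n * of_nat n powr (-(1 + z)))
           \<le> real N powr (-Re z) / (-Re z) + real N powr (-Re z - 1)"
proof -
  have "norm (\<Sum>n=1..N. a n * of_nat n powr (-(1 + z))) \<le> (\<Sum>n=1..N. real n powr (-Re z - 1))"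
  proof (rule sum_norm_le)
    fix n
    have "norm (a n * of_nat n powr (-(1 + z))) = norm (a n) * real n powr (-Re z - 1)"
      unfolding norm_mult norm_nat_powr by (simp add: minus_diff_commute)
    also have "\<dots> \<le> 1 * real n powr (-Re z - 1)"
      by (intro mult_right_mono norm_a) auto
    finally show "norm (a n * of_nat n powr (-(1 + z))) \<le> real n powr (-Re z - 1)" by simp
  qed
  with sum_powr_le[of "-Re z" N] assms show ?thesis by simp
qed

text \<open>
  The kernel \<open>1/z + z/R\<^sup>2\<close> equals \<open>2 Re z / R\<^sup>2\<close> on the circle \<open>|z| = R\<close> and so cancels the factor
  \<open>1 / |Re z|\<close> in the bounds for the tail and for the partial sums. The partial sums are entire and are
  integrated over the left semicircle; \<open>G\<close> is only available slightly to the left of the line, where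
  \<open>N\<^sup>z\<close> tends to 0.
\<close>

lemma Newman_estimate:
  assumes U: "open U" "{s. Re s \<ge> 1} \<subseteq> U" and G: "G holomorphic_on U"
    and sums: "\<And>s. Re s > 1 \<Longrightarrow> (\<lambda>n. a n * of_nat n powr (-s)) sums G s"
    and R: "R > 0"
  obtains E :: "nat \<Rightarrow> real" where "E \<longlonglongrightarrow> 0"
    "\<And>N. N \<ge> 1 \<Longrightarrow> norm (G 1 - (\<Sum>n=1..N. a n / of_nat n)) \<le> 2 / R + 1 / N + E N"
proof -
  define H where "H z = G (1 + z)" for z :: complex
  define U' where "U' = (\<lambda>z. 1 + z) -` U"
  define S where "S N z = (\<Sum>n=1..N. a n * of_nat n powr (-(1 + z)))" for N :: nat and z :: complex
  define k where "k N z = of_nat N powr z * (1 + z\<^sup>2 / of_real (R\<^sup>2))" for N :: nat and z :: complex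
  have U': "open U'"
    unfolding U'_def by (intro continuous_open_vimage U) (auto intro!: continuous_intros)
  have U'_sub: "z \<in> U'" if "Re z \<ge> 0" for z
    using that U(2) by (auto simp: U'_def)
  have holH: "H holomorphic_on U'"
  proof -
    have "(G \<circ> (\<lambda>z. 1 + z)) holomorphic_on U'"
      by (rule holomorphic_on_compose_gen[OF _ G]) (auto intro!: holomorphic_intros simp: U'_def)
    thus ?thesis by (simp add: H_def[abs_def] o_def)
  qed

  \<comment> \<open>Compactness of a segment of the line gives a uniform width \<open>e\<close> of
    holomorphy to its left. The segment reaches beyond height R so that the corners of the contour,
    at height R, are interior.\<close>
  obtain e where e: "e > 0" "(\<Union>x\<in>closed_segment (- \<i> * of_real (R + 1)) (\<i> * of_real (R + 1)). ball x e) \<subseteq> U'"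
  proof (rule compact_subset_open_imp_ball_epsilon_subset[OF compact_segment U'])
    show "closed_segment (- \<i> * of_real (R + 1)) (\<i> * of_real (R + 1)) \<subseteq> U'"
      using U'_sub by (auto simp: closed_segment_def)
  qed
  \<comment> \<open>A convex open half strip, so that Cauchy's formula applies to \<open>H\<close>
    on it. Its points with negative real part lie within \<open>e\<close> of the segment.\<close>
  define V where "V = {z. Re z > -e} \<inter> ({z. Im z > -(R + 1)} \<inter> {z. Im z < R + 1})"
  have V: "open V" "convex V"
    unfolding V_def by (intro open_Int open_halfspace_Re_gt open_halfspace_Im_gt open_halfspace_Im_lt)
      (intro convex_Int convex_halfspace_Re_gt convex_halfspace_Im_gt convex_halfspace_Im_lt)
  have V_sub: "V \<subseteq> U'"
  proof
    fix z assume z: "z \<in> V"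
    show "z \<in> U'"
    proof (cases "Re z \<ge> 0")
      case False
      define q where "q = Im z / (R + 1)"
      define t where "t = (q + 1) / 2"
      have "q > -1" "q < 1"
        using z R by (auto simp: V_def q_def less_divide_eq divide_less_eq)
      hence t: "t \<in> {0..1}" by (auto simp: t_def)
      have "Im z = q * (R + 1)" using R by (simp add: q_def)
      also have "\<dots> = - (1 - t) * (R + 1) + t * (R + 1)"
        by (simp add: t_def field_simps)
      finally have "Im z = - (1 - t) * (R + 1) + t * (R + 1)" .
      hence "\<i> * of_real (Im z) = (1 - t) *\<^sub>R (- \<i> * of_real (R + 1)) + t *\<^sub>R (\<i> * of_real (R + 1))"
        by (simp add: complex_eq_iff algebra_simps)
      hence "\<i> * of_real (Im z) \<in> closed_segment (- \<i> * of_real (R + 1)) (\<i> * of_real (R + 1))"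
        using t by (auto simp: closed_segment_def)
      moreover have "z \<in> ball (\<i> * of_real (Im z)) e"
        using z False by (simp add: V_def dist_norm cmod_def)
      ultimately show ?thesis using e(2) by blast
    qed (use U'_sub in auto)
  qed

  \<comment> \<open>The left path \<open>B\<close> goes around three sides of a rectangle of width
    \<open>d\<close>; half of \<open>e\<close> keeps it inside \<open>V\<close>.\<close>
  define d where "d = e / 2"
  have d: "d > 0" "d < e" using e(1) by (auto simp: d_def)
  define A where "A = part_circlepath 0 R (-(pi / 2)) (pi / 2)"
  define A' where "A' = part_circlepath 0 R (pi / 2) (pi + pi / 2)"
  define B1 where "B1 = linepath (\<i> * of_real R) (Complex (-d) R)"
  define B2 where "B2 = linepath (Complex (-d) R) (Complex (-d) (-R))"
  define B3 where "B3 = linepath (Complex (-d) (-R)) (- \<i> * of_real R)"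
  define B where "B = B1 +++ B2 +++ B3"
  note image_A = semicircle_right_image[OF R, folded A_def]
  note image_A' = semicircle_left_image[OF R, folded A'_def]
  have ex: "exp (\<i> * of_real t) = cis t" for t by (simp add: cis_conv_exp)
  have "cos (pi + pi / 2) = 0" "sin (pi + pi / 2) = -1"
    by (simp_all only: cos_periodic_pi2 sin_periodic_pi2 cos_pi_half sin_pi_half minus_zero)
  hence cis: "cis (pi + pi / 2) = -\<i>" "cis (pi / 2) = \<i>" "cis (-(pi / 2)) = -\<i>"
    by (auto simp only: complex_eq_iff cis.sel) auto
  have ends: "pathstart A = - \<i> * of_real R" "pathfinish A = \<i> * of_real R"
    "pathstart A' = \<i> * of_real R" "pathfinish A' = - \<i> * of_real R"
    "pathstart B = \<i> * of_real R" "pathfinish B = - \<i> * of_real R"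
    unfolding A_def A'_def pathstart_part_circlepath pathfinish_part_circlepath ex cis
    by (simp_all add: B_def B1_def B2_def B3_def)
  have valid: "valid_path A" "valid_path A'" "valid_path B" 
    "valid_path B1" "valid_path B2" "valid_path B3" "valid_path (B2 +++ B3)"
    by (auto simp: A_def A'_def B_def B1_def B2_def B3_def)
  have seg: "Re z \<le> 0 \<and> Re z \<ge> -d \<and> \<bar>Im z\<bar> \<le> R \<and> (Re z = 0 \<longrightarrow> \<bar>Im z\<bar> = R)"
    if z: "z \<in> path_image B1 \<union> path_image B2 \<union> path_image B3" for z
  proof -
    from z consider "z \<in> path_image B1" | "z \<in> path_image B2" | "z \<in> path_image B3" by blast
    thus ?thesis
    proof cases
      case 1
      then obtain u where u: "0 \<le> u" "u \<le> 1" "z = (1 - u) *\<^sub>R (\<i> * of_real R) + u *\<^sub>R Complex (-d) R"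
        by (auto simp: B1_def closed_segment_def)
      have "Re z = - (u * d)" "Im z = R" unfolding u(3) by (simp_all add: algebra_simps)
      thus ?thesis using d R u mult_left_le_one_le[of d u] by simp
    next
      case 2
      then obtain u where u: "0 \<le> u" "u \<le> 1" "z = (1 - u) *\<^sub>R Complex (-d) R + u *\<^sub>R Complex (-d) (-R)"
        by (auto simp: B2_def closed_segment_def)
      have "Re z = -d" "Im z = R * (1 - 2 * u)" unfolding u(3) by (simp_all add: algebra_simps)
      moreover have "\<bar>R * (1 - 2 * u)\<bar> \<le> R * 1"
        unfolding abs_mult using R u by (intro mult_mono) auto
      ultimately show ?thesis using d by simp
    next
      case 3
      then obtain u where u: "0 \<le> u" "u \<le> 1" "z = (1 - u) *\<^sub>R Complex (-d) (-R) + u *\<^sub>R (- \<i> * of_real R)"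
        by (auto simp: B3_def closed_segment_def)
      have "Re z = - ((1 - u) * d)" "Im z = -R" unfolding u(3) by (simp_all add: algebra_simps)
      thus ?thesis using d R u mult_left_le_one_le[of d "1 - u"] by simp
    qed
  qed
  have image_B: "path_image B = path_image B1 \<union> path_image B2 \<union> path_image B3"
    by (simp add: B_def B1_def B2_def B3_def path_image_join Un_assoc)
  have avoid_A: "path_image A \<inter> \<real>\<^sub>\<le>\<^sub>0 = {}"
    using image_A R by (force simp: complex_nonpos_Reals_iff cmod_def)
  have avoid_A': "path_image A' \<inter> \<real>\<^sub>\<ge>\<^sub>0 = {}"
    using image_A' R by (force simp: complex_nonneg_Reals_iff cmod_def)
  have avoid_B: "path_image B \<inter> \<real>\<^sub>\<ge>\<^sub>0 = {}"
    using seg R by (force simp: complex_nonneg_Reals_iff image_B)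
  have nz: "0 \<notin> path_image A" "0 \<notin> path_image A'" "0 \<notin> path_image B"
    using avoid_A avoid_A' avoid_B by auto
  have sub_V: "path_image A \<subseteq> V" "path_image B \<subseteq> V"
  proof -
    show "path_image A \<subseteq> V"
    proof
      fix z assume z: "z \<in> path_image A"
      have "\<bar>Im z\<bar> \<le> R" using abs_Im_le_cmod[of z] image_A(1)[OF z] by simp
      thus "z \<in> V" using image_A(2)[OF z] e(1) by (auto simp: V_def)
    qed
    show "path_image B \<subseteq> V"
      using seg d by (force simp: V_def image_B)
  qed

  have zero_V: "0 \<in> interior V"
    unfolding interior_open[OF V(1)] using R e(1) by (simp add: V_def)
  have hol_k: "k N holomorphic_on X" if "N \<ge> 1" for N X
    unfolding k_def using that R by (intro holomorphic_intros) auto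
  have hol_S: "S N holomorphic_on X" for N X
    unfolding S_def by (intro holomorphic_intros) auto
  have holHV: "H holomorphic_on V"
    using holH V_sub by (rule holomorphic_on_subset)
  have k0: "k N 0 = 1" if "N \<ge> 1" for N using that by (simp add: k_def)

  define E where "E N = norm (contour_integral B (\<lambda>z. H z * k N z / z)) / (2 * pi)" for N

  have "(\<lambda>N. contour_integral B (\<lambda>z. H z * k N z / z)) \<longlonglongrightarrow> 0"
  proof -
    define Q where "Q z = H z * (1 + z\<^sup>2 / of_real (R\<^sup>2)) / z" for z
    have contQ: "continuous_on (path_image B) Q"
      unfolding Q_def using nz(3) R
      by (intro continuous_intros holomorphic_on_imp_continuous_on[OF holomorphic_on_subset[OF holHV sub_V(2)]])
         auto
    have eq: "H z * k N z / z = Q z * of_nat N powr z" for N :: nat and z :: complex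
      by (simp add: Q_def k_def)
    have contB: "continuous_on (path_image B1) Q" "continuous_on (path_image B2) Q"
       "continuous_on (path_image B3) Q"
      using contQ by (auto intro: continuous_on_subset simp: image_B)
    have Re_B: "Re (linepath (\<i> * of_real R) (Complex (-d) R) t) = - (t * d)"
        "Re (linepath (Complex (-d) R) (Complex (-d) (-R)) t) = - d"
        "Re (linepath (Complex (-d) (-R)) (- (\<i> * of_real R)) t) = - ((1 - t) * d)" for t
      by (simp_all add: linepath_def algebra_simps)
    have lims: "(\<lambda>N. contour_integral B1 (\<lambda>z. Q z * of_nat N powr z)) \<longlonglongrightarrow> 0"
          "(\<lambda>N. contour_integral B2 (\<lambda>z. Q z * of_nat N powr z)) \<longlonglongrightarrow> 0"
          "(\<lambda>N. contour_integral B3 (\<lambda>z. Q z * of_nat N powr z)) \<longlonglongrightarrow> 0"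
      unfolding B1_def B2_def B3_def
      by (rule contour_integral_linepath_decay; use contB d in \<open>simp add: B1_def B2_def B3_def Re_B\<close>)+
    have "contour_integral B (\<lambda>z. Q z * of_nat N powr z) = 
            contour_integral B1 (\<lambda>z. Q z * of_nat N powr z) + 
            (contour_integral B2 (\<lambda>z. Q z * of_nat N powr z) + 
            contour_integral B3 (\<lambda>z. Q z * of_nat N powr z))" if "N \<ge> 1" for N
    proof -
      have "(\<lambda>z. Q z * of_nat N powr z) contour_integrable_on B1"
           "(\<lambda>z. Q z * of_nat N powr z) contour_integrable_on B2"
           "(\<lambda>z. Q z * of_nat N powr z) contour_integrable_on B3"
        using contB that unfolding B1_def B2_def B3_def
        by (auto intro!: contour_integrable_continuous_linepath continuous_intros)
      thus ?thesis unfolding B_def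
        by (subst contour_integral_join contour_integral_join, auto simp: valid)+
    qed
    hence "eventually (\<lambda>N. contour_integral B1 (\<lambda>z. Q z * of_nat N powr z) + 
            (contour_integral B2 (\<lambda>z. Q z * of_nat N powr z) + 
            contour_integral B3 (\<lambda>z. Q z * of_nat N powr z)) =
          contour_integral B (\<lambda>z. Q z * of_nat N powr z)) sequentially"
      by (intro eventually_sequentiallyI[of 1]) auto
    moreover have "(\<lambda>N. contour_integral B1 (\<lambda>z. Q z * of_nat N powr z) + 
            (contour_integral B2 (\<lambda>z. Q z * of_nat N powr z) + 
            contour_integral B3 (\<lambda>z. Q z * of_nat N powr z))) \<longlonglongrightarrow> 0 + (0 + 0)"
      by (intro tendsto_add lims)
    ultimately show ?thesis
      unfolding eq by (simp add: Lim_transform_eventually)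
  qed
  hence E: "E \<longlonglongrightarrow> 0"
    unfolding E_def by (auto intro!: tendsto_eq_intros)

  have "norm (G 1 - (\<Sum>n=1..N. a n / of_nat n)) \<le> 2 / R + 1 / N + E N" if N: "N \<ge> 1" for N
  proof -
    have intH: "((\<lambda>z. H z * k N z / (z - 0)) has_contour_integral
            (2 * pi * \<i> * winding_number (A +++ B) 0 * (H 0 * k N 0))) (A +++ B)"
      using sub_V nz zero_V by (intro Cauchy_integral_formula_convex_simple[OF V(2)] holomorphic_intros
             hol_k holHV N valid)
         (auto simp: path_image_join ends valid)
    have intS: "((\<lambda>z. S N z * k N z / (z - 0)) has_contour_integral
            (2 * pi * \<i> * winding_number (A +++ A') 0 * (S N 0 * k N 0))) (A +++ A')"
      using nz by (intro Cauchy_integral_formula_convex_simple[OF convex_UNIV] holomorphic_intros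
             hol_k hol_S N valid)
         (auto simp: path_image_join ends valid)
    have w: "winding_number (A +++ B) 0 = 1" "winding_number (A +++ A') 0 = 1"
      by (rule winding_number_join_halves[of _ R]; use R ends valid avoid_A avoid_A' avoid_B in simp)+
    have cH: "(\<lambda>z. H z * k N z / z) contour_integrable_on A"
             "(\<lambda>z. H z * k N z / z) contour_integrable_on B"
      using contour_integrable_joinD1[of _ A B] contour_integrable_joinD2[of _ A B]
        has_contour_integral_integrable[OF intH] valid by simp_all
    have cS: "(\<lambda>z. S N z * k N z / z) contour_integrable_on A"
             "(\<lambda>z. S N z * k N z / z) contour_integrable_on A'"
      using contour_integrable_joinD1[of _ A A'] contour_integrable_joinD2[of _ A A']
        has_contour_integral_integrable[OF intS] valid by simp_all
    have eqH: "2 * pi * \<i> * H 0 = contour_integral A (\<lambda>z. H z * k N z / z) +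
             contour_integral B (\<lambda>z. H z * k N z / z)"
      using contour_integral_unique[OF intH] cH valid by (simp add: w k0[OF N])
    have eqS: "2 * pi * \<i> * S N 0 = contour_integral A (\<lambda>z. S N z * k N z / z) +
             contour_integral A' (\<lambda>z. S N z * k N z / z)"
      using contour_integral_unique[OF intS] cS valid by (simp add: w k0[OF N])
    define IA where "IA = contour_integral A (\<lambda>z. H z * k N z / z - S N z * k N z / z)"
    define IA' where "IA' = contour_integral A' (\<lambda>z. S N z * k N z / z)"
    define IB where "IB = contour_integral B (\<lambda>z. H z * k N z / z)"
    have eq: "2 * pi * \<i> * (H 0 - S N 0) = IA - IA' + IB"
      unfolding IA_def IA'_def IB_def contour_integral_diff[OF cH(1) cS(1)] right_diff_distrib eqH eqS
      by simp

    have k_circle: "norm (k N z / z) = real N powr Re z * (2 * \<bar>Re z\<bar> / R\<^sup>2)" if "norm z = R" for z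
    proof -
      have "k N z / z = of_nat N powr z * ((1 + z\<^sup>2 / of_real (R\<^sup>2)) / z)" by (simp add: k_def)
      also have "norm \<dots> = real N powr Re z * (2 * \<bar>Re z\<bar> / R\<^sup>2)"
        unfolding Newman_kernel_on_circle[OF that R] norm_mult norm_nat_powr norm_of_real
        by (simp add: abs_mult)
      finally show ?thesis .
    qed
    have "norm IA \<le> 2 / R\<^sup>2 * R * (pi / 2 - (- (pi / 2)))"
      unfolding IA_def A_def
    proof (rule contour_integral_bound_part_circlepath_strong[where k = "{\<i> * of_real R, - \<i> * of_real R}"];
           (fold A_def)?)
      show "(\<lambda>z. H z * k N z / z - S N z * k N z / z) contour_integrable_on A"
        using cH cS by (intro contour_integrable_diff) auto
      fix z assume z: "z \<in> path_image A - {\<i> * of_real R, - \<i> * of_real R}"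
      have nz: "norm z = R" using image_A z by auto
      have Re: "Re z > 0" using image_A(2)[of z] norm_eq_Re_0_imp[OF nz] z by force
      have "norm (H z - S N z) \<le> real N powr (-Re z) / Re z"
        unfolding H_def S_def using Re N sums[of "1 + z"] by (intro dirichlet_tail_bound) auto
      hence "norm (H z - S N z) * norm (k N z / z) \<le>
               real N powr (-Re z) / Re z * (real N powr Re z * (2 * \<bar>Re z\<bar> / R\<^sup>2))"
        unfolding k_circle[OF nz] by (intro mult_right_mono) auto
      also have "\<dots> = (real N powr (-Re z) * real N powr Re z) * 2 / R\<^sup>2"
        using Re by (simp add: field_simps)
      also have "real N powr (-Re z) * real N powr Re z = 1"
        using N by (simp flip: powr_add)
      finally show "norm (H z * k N z / z - S N z * k N z / z) \<le> 2 / R\<^sup>2"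
        by (simp add: norm_mult norm_divide flip: left_diff_distrib diff_divide_distrib)
    qed (use R in auto)
    hence IA: "norm IA \<le> 2 * pi / R" using R by (simp add: power2_eq_square)
    \<comment> \<open>The first summand comes from N^x / x with x = -Re z, the second from the extra
      term N^(x-1) together with x \<le> R; the remaining factor is the arc length pi R.\<close>
    have "norm IA' \<le> (2 / R\<^sup>2 + 2 / (R * N)) * R * (pi + pi / 2 - pi / 2)"
      unfolding IA'_def A'_def
    proof (rule contour_integral_bound_part_circlepath_strong[where k = "{\<i> * of_real R, - \<i> * of_real R}"];
           (fold A'_def)?)
      show "(\<lambda>z. S N z * k N z / z) contour_integrable_on A'" by (rule cS)
      fix z assume z: "z \<in> path_image A' - {\<i> * of_real R, - \<i> * of_real R}"
      have nz: "norm z = R" using image_A' z by auto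
      have Re: "Re z < 0" using image_A'(2)[of z] norm_eq_Re_0_imp[OF nz] z by force
      define x where "x = - Re z"
      have x: "x > 0" "x \<le> R" using Re nz abs_Re_le_cmod[of z] by (auto simp: x_def)
      have "norm (S N z) \<le> real N powr x / x + real N powr (x - 1)"
        unfolding S_def x_def by (rule dirichlet_partial_sum_bound[OF Re])
      hence "norm (S N z) * norm (k N z / z) \<le>
               (real N powr x / x + real N powr (x - 1)) * (real N powr Re z * (2 * \<bar>Re z\<bar> / R\<^sup>2))"
        unfolding k_circle[OF nz] by (intro mult_right_mono) auto
      also have "real N powr (x - 1) = real N powr x / N"
        using N by (simp add: powr_diff)
      also have "real N powr Re z = 1 / real N powr x"
        by (simp add: x_def powr_minus field_simps)
      also have "\<bar>Re z\<bar> = x" using Re by (simp add: x_def)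
      also have "(y / x + y / N) * (1 / y * (2 * x / R\<^sup>2)) = 2 / R\<^sup>2 + 2 * (x / R) / (R * N)"
        if "y > 0" for y
        using that N x(1) R by (simp add: field_simps power2_eq_square)
      hence "(real N powr x / x + real N powr x / N) * (1 / real N powr x * (2 * x / R\<^sup>2)) =
             2 / R\<^sup>2 + 2 * (x / R) / (R * N)"
        using N by simp
      also have "\<dots> \<le> 2 / R\<^sup>2 + 2 * 1 / (R * N)"
        using x R N by (intro add_left_mono divide_right_mono mult_left_mono) auto
      finally show "norm (S N z * k N z / z) \<le> 2 / R\<^sup>2 + 2 / (R * N)"
        by (simp add: norm_mult norm_divide)
    qed (use R in auto)
    also have "(2 / R\<^sup>2 + 2 / (R * N)) * R * (pi + pi / 2 - pi / 2) = 2 * pi / R + 2 * pi / N"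
      using R N by (simp add: field_simps power2_eq_square)
    finally have IA': "norm IA' \<le> 2 * pi / R + 2 * pi / N" .
    have "norm (2 * pi * \<i> * (H 0 - S N 0)) \<le> norm IA + norm IA' + norm IB"
      unfolding eq using norm_triangle_ineq[of "IA - IA'" IB] norm_triangle_ineq4[of IA IA'] by linarith
    hence "2 * pi * norm (H 0 - S N 0) \<le> 2 * pi / R + (2 * pi / R + 2 * pi / N) + norm IB"
      using IA IA' by (simp add: norm_mult)
    also have "\<dots> = 2 * pi * (2 / R + 1 / N + E N)"
      by (simp add: E_def IB_def algebra_simps)
    finally have "norm (H 0 - S N 0) \<le> 2 / R + 1 / N + E N" by simp
    moreover have "S N 0 = (\<Sum>n=1..N. a n / of_nat n)"
      unfolding S_def by (intro sum.cong) (auto simp: powr_minus field_simps)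
    ultimately show ?thesis by (simp add: H_def)
  qed
  with E show ?thesis by (rule that)
qed

theorem Newman_tauberian:
  assumes "open U" "{s. Re s \<ge> 1} \<subseteq> U" "G holomorphic_on U"
    and "\<And>s. Re s > 1 \<Longrightarrow> (\<lambda>n. a n * of_nat n powr (-s)) sums G s"
  shows "(\<lambda>N. \<Sum>n=1..N. a n / of_nat n) \<longlonglongrightarrow> G 1"
proof (rule metric_LIMSEQ_I)
  fix r :: real assume r: "r > 0"
  \<comment> \<open>The error \<open>E\<close> belongs to one contour, so R must be fixed before N
    grows. With R = 4/r the part that does not tend to 0 is 2/R = r/2.\<close>
  obtain E :: "nat \<Rightarrow> real" where E: "E \<longlonglongrightarrow> 0"
    "\<And>N. N \<ge> 1 \<Longrightarrow> norm (G 1 - (\<Sum>n=1..N. a n / of_nat n)) \<le> 2 / (4 / r) + 1 / N + E N"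
    by (rule Newman_estimate[OF assms, of "4 / r"]) (use r in auto)
  have "(\<lambda>N. 1 / real N + E N) \<longlonglongrightarrow> 0 + 0"
    by (intro tendsto_add E lim_1_over_n)
  hence "eventually (\<lambda>N. 1 / real N + E N < r / 2) sequentially"
    using r by (intro order_tendstoD(2)[of _ 0]) auto
  hence "eventually (\<lambda>N. dist (\<Sum>n=1..N. a n / of_nat n) (G 1) < r) sequentially"
    using eventually_ge_at_top[of 1]
  proof eventually_elim
    case (elim N)
    thus ?case using E(2)[of N] by (simp add: dist_norm norm_minus_commute)
  qed
  thus "\<exists>M. \<forall>N\<ge>M. dist (\<Sum>n=1..N. a n / of_nat n) (G 1) < r"
    by (simp add: eventually_sequentially)
qed

end

section \<open>The zeta function without its pole\<close>

text \<open>
  \<open>zeta_pole s\<close> is \<open>(s - 1) \<zeta>(s)\<close>: the term is \<open>s - 1\<close> times \<open>(n+1)\<^sup>-\<^sup>s\<close> minus the integral of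
  \<open>x\<^sup>-\<^sup>s\<close> over \<open>[n+1, n+2]\<close>, which makes the series converge for \<open>Re s > 0\<close>.
\<close>

definition zeta_pole_term :: "nat \<Rightarrow> complex \<Rightarrow> complex" where
  "zeta_pole_term n s = (s - 1) * of_nat (Suc n) powr (-s)
     + of_nat (Suc (Suc n)) powr (1 - s) - of_nat (Suc n) powr (1 - s)"

definition zeta_pole :: "complex \<Rightarrow> complex" where
  "zeta_pole s = 1 + (\<Sum>n. zeta_pole_term n s)"

text \<open>With m = n + 1, the term is the first-order Taylor remainder of x^(1-s) at m, evaluated
  at m + 1: the derivative there is (1-s) m^(-s). The second derivative (1-s)(-s) x^(-s-1) is
  largest in norm at x = m.\<close>

lemma norm_zeta_pole_term:
  assumes "Re s > 0"
  shows "norm (zeta_pole_term n s) \<le> norm (s - 1) * norm s * real (Suc n) powr (-Re s - 1)"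
proof -
  define m where "m = real (Suc n)"
  have m: "m > 0" by (simp add: m_def)
  define T where "T = closed_segment (of_real m) (of_real (m + 1) :: complex)"
  define f :: "nat \<Rightarrow> complex \<Rightarrow> complex" where
    "f i x = (if i = 0 then x powr (1 - s) else if i = 1 then (1 - s) * x powr (-s)
                else (1 - s) * (-s * x powr (-s - 1)))" for i x
  have T: "\<exists>r. x = of_real r \<and> m \<le> r \<and> r \<le> m + 1" if "x \<in> T" for x
    using that unfolding T_def closed_segment_of_real by (auto simp: closed_segment_eq_real_ivl)
  have "norm (f 0 (of_real (m + 1)) - (\<Sum>i\<le>1. f i (of_real m) * (of_real (m + 1) - of_real m) ^ i / fact i))
     \<le> (norm (s - 1) * norm s * m powr (-Re s - 1)) * norm (of_real (m + 1) - of_real m :: complex) ^ Suc 1 / fact 1"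
  proof (rule complex_Taylor)
    show "convex T" by (simp add: T_def)
    show "of_real m \<in> T" "of_real (m + 1) \<in> T" by (simp_all add: T_def)
    fix i x assume x: "x \<in> T" and i: "i \<le> (1 :: nat)"
    from T[OF x] m have "x \<notin> \<real>\<^sub>\<le>\<^sub>0" by (auto simp: complex_nonpos_Reals_iff)
    hence powr: "((\<lambda>x. x powr c) has_field_derivative c * x powr (c - 1)) (at x within T)" for c
      by (rule has_field_derivative_at_within[OF has_field_derivative_powr])
    have "i = 0 \<or> i = 1" using i by auto
    thus "(f i has_field_derivative f (Suc i) x) (at x within T)"
      using powr[of "1 - s"] DERIV_cmult[OF powr[of "-s"], of "1 - s"] by (auto simp: f_def[abs_def])
  next
    fix x assume x: "x \<in> T"
    then obtain r where r: "x = of_real r" "m \<le> r" using T by blast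
    have "norm (f (Suc 1) x) = norm (s - 1) * norm s * r powr (-Re s - 1)"
      using r m by (simp add: f_def norm_mult norm_powr_real_powr norm_minus_commute)
    also have "\<dots> \<le> norm (s - 1) * norm s * m powr (-Re s - 1)"
      using r m assms by (intro mult_left_mono powr_mono2') auto
    finally show "norm (f (Suc 1) x) \<le> norm (s - 1) * norm s * m powr (-Re s - 1)" .
  qed
  moreover have "f 0 (of_real (m + 1)) - (\<Sum>i\<le>1. f i (of_real m) * (of_real (m + 1) - of_real m) ^ i / fact i)
      = zeta_pole_term n s"
    by (simp add: f_def zeta_pole_term_def m_def algebra_simps)
  ultimately show ?thesis by (simp add: m_def)
qed

lemma summable_Suc_powr:
  assumes "(x :: real) < -1"
  shows "summable (\<lambda>n. real (Suc n) powr x)"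
  using assms summable_real_powr_iff[of x] summable_Suc_iff[of "\<lambda>n. real n powr x"] by simp

lemma holomorphic_zeta_pole: "zeta_pole holomorphic_on {s. Re s > 0}"
proof -
  have "(\<lambda>s. \<Sum>n. zeta_pole_term n s) holomorphic_on {s. Re s > 0}"
  proof (rule holomorphic_uniform_sequence[where f = "\<lambda>N s. \<Sum>n<N. zeta_pole_term n s"])
    show "open {s. Re s > 0}" by (rule open_halfspace_Re_gt)
    show "(\<lambda>s. \<Sum>n<N. zeta_pole_term n s) holomorphic_on {s. Re s > 0}" for N
      unfolding zeta_pole_term_def by (intro holomorphic_intros) (auto simp del: of_nat_Suc)
    fix x assume x: "x \<in> {s. Re s > 0}"
    define d where "d = Re x / 2"
    have d: "d > 0" using x by (simp add: d_def)
    have ball: "Re s \<ge> d \<and> norm s \<le> norm x + d" if "s \<in> cball x d" for s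
    proof -
      have "norm (s - x) \<le> d" using that by (simp add: dist_norm norm_minus_commute)
      moreover have "\<bar>Re (s - x)\<bar> \<le> norm (s - x)" by (rule abs_Re_le_cmod)
      moreover have "norm s \<le> norm x + norm (s - x)" using norm_triangle_sub by blast
      ultimately show ?thesis by (auto simp: d_def)
    qed
    have "uniform_limit (cball x d) (\<lambda>N s. \<Sum>n<N. zeta_pole_term n s)
            (\<lambda>s. \<Sum>n. zeta_pole_term n s) sequentially"
    proof (rule Weierstrass_m_test)
      show "summable (\<lambda>n. ((norm x + d + 1) * (norm x + d)) * real (Suc n) powr (-d - 1))"
        using d by (intro summable_mult summable_Suc_powr) auto
      fix n s assume s: "s \<in> cball x d"
      have "norm (zeta_pole_term n s) \<le> norm (s - 1) * norm s * real (Suc n) powr (-Re s - 1)"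
        using ball[OF s] d by (intro norm_zeta_pole_term) auto
      also have "\<dots> \<le> ((norm x + d + 1) * (norm x + d)) * real (Suc n) powr (-d - 1)"
        using ball[OF s] d norm_triangle_ineq4[of s 1]
        by (intro mult_mono powr_mono) auto
      finally show "norm (zeta_pole_term n s) \<le>
         ((norm x + d + 1) * (norm x + d)) * real (Suc n) powr (-d - 1)" .
    qed
    moreover have "cball x d \<subseteq> {s. Re s > 0}" using ball d by force
    ultimately show "\<exists>d>0. cball x d \<subseteq> {s. Re s > 0} \<and>
        uniform_limit (cball x d) (\<lambda>N s. \<Sum>n<N. zeta_pole_term n s) (\<lambda>s. \<Sum>n. zeta_pole_term n s) sequentially"
      using d by blast
  qed
  thus ?thesis unfolding zeta_pole_def[abs_def] by (intro holomorphic_intros)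
qed

lemma zeta_pole_1 [simp]: "zeta_pole 1 = 1"
  by (simp add: zeta_pole_def zeta_pole_term_def del: of_nat_Suc)

lemma norm_Suc_powr: "norm (of_nat (Suc n) powr (s :: complex)) = real (Suc n) powr Re s"
  by (rule norm_nat_powr)

text \<open>In the region of absolute convergence the two parts of the term can be summed
  separately. The powers with exponent 1 - s telescope to -1, which cancels the leading 1 in
  \<open>zeta_pole\<close>.\<close>

lemma zeta_pole_eq:
  assumes "Re s > 1"
  shows "zeta_pole s = (s - 1) * (\<Sum>n. of_nat (Suc n) powr (-s))"
proof -
  define f where "f n = of_nat (Suc n) powr (1 - s)" for n
  have "(\<lambda>n. real (Suc n) powr (1 - Re s)) \<longlonglongrightarrow> 0"
    using assms by real_asymp
  hence "f \<longlonglongrightarrow> 0"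
    by (intro tendsto_norm_zero_cancel[of f]) (simp add: f_def norm_Suc_powr del: of_nat_Suc)
  hence "(\<lambda>n. f (Suc n) - f n) sums (0 - f 0)" by (rule telescope_sums)
  moreover have "summable (\<lambda>n. of_nat (Suc n) powr (-s))"
    by (rule summable_norm_cancel, unfold norm_Suc_powr, rule summable_Suc_powr) (use assms in auto)
  hence "(\<lambda>n. (s - 1) * of_nat (Suc n) powr (-s)) sums ((s - 1) * (\<Sum>n. of_nat (Suc n) powr (-s)))"
    by (intro sums_mult summable_sums)
  ultimately have "(\<lambda>n. (s - 1) * of_nat (Suc n) powr (-s) + (f (Suc n) - f n)) sums
     ((s - 1) * (\<Sum>n. of_nat (Suc n) powr (-s)) + (0 - f 0))"
    by (intro sums_add)
  moreover have "f 0 = 1" by (simp add: f_def)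
  ultimately show ?thesis
    unfolding zeta_pole_def zeta_pole_term_def by (simp add: sums_iff f_def algebra_simps)
qed

section \<open>The Dirichlet series of the Moebius function\<close>

lemma moebius_0 [simp]: "moebius 0 = 0"
  by (simp add: moebius_def)

lemma moebius_1 [simp]: "moebius 1 = 1" "moebius (Suc 0) = 1"
  by (simp_all add: moebius_def)

lemma abs_moebius_le_1: "\<bar>moebius n\<bar> \<le> 1"
  by (simp add: moebius_def power_abs)

lemma moebius_prime_mult:
  assumes "prime p" "\<not> p dvd m"
  shows "moebius (p * m) = - moebius m"
proof (cases "squarefree m")
  case True
  have cop: "coprime p m" using assms prime_imp_coprime by blast
  have "squarefree (p * m)"
    by (rule squarefree_mult_coprime[OF cop squarefree_prime[OF assms(1)] True])
  moreover have "m \<noteq> 0" using assms(2) by (metis dvd_0_right)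
  hence "prime_factors (p * m) = insert p (prime_factors m)"
    using assms by (simp add: prime_factors_product prime_prime_factors)
  moreover have "p \<notin> prime_factors m" using assms by (auto simp: prime_factors_dvd)
  ultimately show ?thesis using True by (simp add: moebius_def)
next
  case False
  hence "\<not> squarefree (p * m)" using squarefree_mono[of m "p * m"] by auto
  with False show ?thesis by (simp add: moebius_def)
qed

lemma moebius_prime_square_mult:
  assumes "prime p"
  shows "moebius (p * (p * m)) = 0"
proof -
  have "p ^ 2 dvd p * (p * m)" by (simp add: power2_eq_square flip: mult.assoc)
  moreover have "\<not> p dvd 1" using assms not_prime_unit by blast
  ultimately have "\<not> squarefree (p * (p * m))" by (rule not_squarefreeI)
  thus ?thesis by (simp add: moebius_def)
qed

text \<open>Numbers prime to p and p times such numbers cancel in pairs, and multiples of p^2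
  contribute nothing; this includes 0, as 0 = p * (p * 0). It serves both the divisor sum of mu and
  the rows of the gcd sum.\<close>

lemma infsum_cancel_prime_multiples:
  fixes g :: "nat \<Rightarrow> real"
  assumes p: "prime p" and summ: "g summable_on UNIV"
    and neg: "\<And>m. \<not> p dvd m \<Longrightarrow> g (p * m) = - g m"
    and zero: "\<And>m. g (p * (p * m)) = 0"
  shows "infsum g UNIV = 0"
proof -
  define A where "A = {m. \<not> p dvd m}"
  have p0: "p > 0" using p prime_gt_0_nat by blast
  have sub: "g summable_on X" for X
    using summ summable_on_subset_banach by blast
  have "infsum g UNIV = infsum g (A \<union> (\<lambda>m. p * m) ` A)"
  proof (rule infsum_cong_neutral)
    fix m assume m: "m \<in> UNIV - (A \<union> (\<lambda>m. p * m) ` A)"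
    hence "p dvd m" by (auto simp: A_def)
    then obtain k where k: "m = p * k" by blast
    with m have "p dvd k" by (auto simp: A_def)
    with k show "g m = 0" using zero by auto
  qed auto
  also have "\<dots> = infsum g A + infsum g ((\<lambda>m. p * m) ` A)"
    by (intro infsum_Un_disjoint sub) (auto simp: A_def)
  also have "infsum g ((\<lambda>m. p * m) ` A) = infsum (g \<circ> (\<lambda>m. p * m)) A"
    using p0 by (intro infsum_reindex) (auto simp: inj_on_def)
  also have "\<dots> = infsum (\<lambda>m. - g m) A"
    by (intro infsum_cong) (auto simp: A_def neg)
  also have "\<dots> = - infsum g A" by (rule infsum_uminus)
  finally show ?thesis by simp
qed

lemma sum_moebius_divisors:
  assumes "n > 0"
  shows "(\<Sum>d | d dvd n. moebius d) = (if n = 1 then 1 else 0)"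
proof (cases "n = 1")
  case False
  then obtain p where p: "prime p" "p dvd n" using prime_factor_nat by blast
  \<comment> \<open>Extension by 0 to all naturals brings the finite divisor sum into the form of
    the cancellation lemma. For m prime to p, both m and p * m divide n or neither does.\<close>
  define g where "g d = (if d dvd n then moebius d else 0)" for d
  have fin: "finite {d. d dvd n}" using assms by simp
  have "(g has_sum (\<Sum>d | d dvd n. moebius d)) {d. d dvd n}"
    using fin by (intro has_sum_finiteI) (auto simp: g_def intro!: sum.cong)
  hence *: "(g has_sum (\<Sum>d | d dvd n. moebius d)) UNIV"
    by (subst has_sum_cong_neutral[where T = "{d. d dvd n}" and g = g]) (auto simp: g_def)
  have "infsum g UNIV = 0"
  proof (rule infsum_cancel_prime_multiples[OF p(1)])
    show "g summable_on UNIV" using * by (rule has_sum_imp_summable)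
    show "g (p * m) = - g m" if "\<not> p dvd m" for m
    proof -
      have "coprime p m" using p(1) that prime_imp_coprime by blast
      hence "p * m dvd n \<longleftrightarrow> m dvd n" using p(2) divides_mult[of p n m] by (auto dest: dvd_mult_right)
      thus ?thesis using moebius_prime_mult[OF p(1) that] by (simp add: g_def)
    qed
    show "g (p * (p * m)) = 0" for m using moebius_prime_square_mult[OF p(1)] by (simp add: g_def)
  qed
  with * False show ?thesis by (simp add: infsumI)
qed simp

lemma has_sum_product_abs:
  fixes u :: "'a \<Rightarrow> 'c :: {banach, real_normed_field}" and v :: "'b \<Rightarrow> 'c"
  assumes u: "(\<lambda>x. norm (u x)) summable_on A" and v: "(\<lambda>y. norm (v y)) summable_on B"
  shows "((\<lambda>(x, y). u x * v y) has_sum (infsum u A * infsum v B)) (A \<times> B)"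
    and "(\<lambda>x. norm ((\<lambda>(x, y). u x * v y) x)) summable_on (A \<times> B)"
proof -
  show "(\<lambda>x. norm ((\<lambda>(x, y). u x * v y) x)) summable_on (A \<times> B)"
    unfolding Infinite_Sum.abs_summable_on_Sigma_iff using u v
    by (simp add: norm_mult infsum_cmult_right' summable_on_cmult_right summable_on_cmult_left
          infsum_nonneg)
  hence "(\<lambda>(x, y). u x * v y) summable_on (A \<times> B)" by (rule abs_summable_summable)
  moreover from this have "infsum (\<lambda>(x, y). u x * v y) (A \<times> B) = infsum u A * infsum v B"
    by (subst infsum_Sigma'_banach[symmetric]) (simp_all add: infsum_cmult_right' infsum_cmult_left')
  ultimately show "((\<lambda>(x, y). u x * v y) has_sum (infsum u A * infsum v B)) (A \<times> B)"
    by (simp add: has_sum_iff)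
qed

lemma nat_powr_mult: "of_nat (m * n) powr (z :: complex) = of_nat m powr z * of_nat n powr z"
  unfolding of_nat_mult by (rule powr_times_real) auto

lemma abs_summable_nat_powr:
  assumes "Re s > 1"
  shows "(\<lambda>n. norm (of_nat n powr (-s))) summable_on X"
proof -
  have "(\<lambda>n. real n powr (- Re s)) summable_on UNIV"
    using assms by (intro summable_nonneg_imp_summable_on) (auto simp: summable_real_powr_iff)
  thus ?thesis unfolding norm_nat_powr
    by (simp, rule summable_on_subset_banach) auto
qed

lemma abs_summable_moebius_powr:
  assumes "Re s > 1"
  shows "(\<lambda>n. norm (of_real (moebius n) * of_nat n powr (-s))) summable_on X"
proof (rule Infinite_Sum.abs_summable_on_comparison_test[OF abs_summable_nat_powr[OF assms]])
  fix n
  have "\<bar>moebius n\<bar> * norm (of_nat n powr (-s)) \<le> 1 * norm (of_nat n powr (-s))"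
    by (intro mult_right_mono abs_moebius_le_1) auto
  thus "norm (of_real (moebius n) * of_nat n powr (-s)) \<le> norm (of_nat n powr (-s))"
    by (simp add: norm_mult)
qed

text \<open>On Re s > 1 this is 1/zeta(s).\<close>

definition moebius_series :: "complex \<Rightarrow> complex" where
  "moebius_series s = (\<Sum>\<^sub>\<infinity>n. of_real (moebius n) * of_nat n powr (-s))"

lemma moebius_series_has_sum:
  "Re s > 1 \<Longrightarrow> ((\<lambda>n. of_real (moebius n) * of_nat n powr (-s)) has_sum moebius_series s) UNIV"
  unfolding moebius_series_def by (rule has_sum_infsum[OF abs_summable_summable[OF abs_summable_moebius_powr]])

text \<open>Grouping the pairs (d, k) by n = d k leaves \<open>v n\<close> times the divisor sum of
  mu, so only n = 1 survives. The completely multiplicative \<open>v\<close> is kept general: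
  complex powers n^(-s) and the real sequence 1/n^2 are both needed.\<close>

lemma moebius_convolution_infsum:
  fixes v :: "nat \<Rightarrow> 'c :: {banach, real_normed_field}"
  assumes v: "(\<lambda>n. norm (v n)) summable_on {1..}" and mult: "\<And>m n. v (m * n) = v m * v n" and v1: "v 1 = 1"
  shows "(\<Sum>\<^sub>\<infinity>n\<in>{1..}. of_real (moebius n) * v n) * (\<Sum>\<^sub>\<infinity>n\<in>{1..}. v n) = 1"
proof -
  define u where "u n = of_real (moebius n) * v n" for n
  have u: "(\<lambda>n. norm (u n)) summable_on {1..}"
  proof (rule Infinite_Sum.abs_summable_on_comparison_test[OF v])
    fix n
    have "\<bar>moebius n\<bar> * norm (v n) \<le> 1 * norm (v n)"
      by (intro mult_right_mono abs_moebius_le_1) auto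
    thus "norm (u n) \<le> norm (v n)" by (simp add: norm_mult u_def)
  qed
  have bij: "bij_betw (\<lambda>(d, k). (d * k, d)) ({1..} \<times> {1..}) (SIGMA n:{1::nat..}. {d. d dvd n})"
    by (rule bij_betwI[where g = "\<lambda>(n, d). (d, n div d)"])
       (auto simp: Suc_le_eq elim!: dvdE)
  have "((\<lambda>(d, k). u d * v k) has_sum (infsum u {1..} * infsum v {1..})) ({1..} \<times> {1..})"
    using u v by (rule has_sum_product_abs)
  hence "((\<lambda>x. (\<lambda>(n, d). of_real (moebius d) * v n) ((\<lambda>(d, k). (d * k, d)) x)) has_sum
           (infsum u {1..} * infsum v {1..})) ({1..} \<times> {1..})"
    by (rule has_sum_cong[THEN iffD1, rotated]) (auto simp: u_def mult mult_ac)
  hence sum: "((\<lambda>(n, d). of_real (moebius d) * v n) has_sum (infsum u {1..} * infsum v {1..}))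
           (SIGMA n:{1..}. {d. d dvd n})"
    using has_sum_reindex_bij_betw[OF bij] by blast
  have inner: "((\<lambda>d. of_real (moebius d) * v n) has_sum (if n = 1 then 1 else 0)) {d. d dvd n}"
    if "n \<in> {1..}" for n
  proof (rule has_sum_finiteI)
    show "finite {d. d dvd n}" using that by auto
    have "(\<Sum>d | d dvd n. of_real (moebius d) * v n) = of_real (\<Sum>d | d dvd n. moebius d) * v n"
      by (simp add: sum_distrib_right)
    also have "\<dots> = (if n = 1 then 1 else 0)"
      using that by (subst sum_moebius_divisors) (auto simp: v1 simp del: One_nat_def)
    finally show "(if n = 1 then 1 else 0) = (\<Sum>d | d dvd n. of_real (moebius d) * v n)" ..
  qed
  have "((\<lambda>n::nat. if n = 1 then 1 else 0 :: 'c) has_sum (infsum u {1..} * infsum v {1..})) {1..}"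
    using has_sum_SigmaD[OF sum] inner by simp
  moreover have "((\<lambda>n::nat. if n = 1 then 1 else 0 :: 'c) has_sum 1) {1..}"
    by (rule has_sum_finite_neutralI[of "{1}"]) auto
  ultimately show ?thesis unfolding u_def using has_sum_unique by blast
qed

text \<open>This is (1/zeta) * zeta = 1 multiplied by s - 1. As a product it shows at once that
  \<open>zeta_pole\<close> has no zero with Re s > 1.\<close>

lemma moebius_series_mult_zeta_pole:
  assumes "Re s > 1"
  shows "moebius_series s * zeta_pole s = s - 1"
proof -
  define v :: "nat \<Rightarrow> complex" where "v n = of_nat n powr (-s)" for n
  have "(\<Sum>\<^sub>\<infinity>n\<in>{1..}. of_real (moebius n) * v n) * (\<Sum>\<^sub>\<infinity>n\<in>{1..}. v n) = 1"
    using abs_summable_nat_powr[OF assms]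
    by (intro moebius_convolution_infsum) (auto simp: v_def nat_powr_mult simp del: of_nat_mult)
  moreover have "(\<Sum>\<^sub>\<infinity>n\<in>{1..}. of_real (moebius n) * v n) = moebius_series s"
    unfolding moebius_series_def v_def by (rule infsum_cong_neutral) (auto simp: not_le)
  moreover have "(\<Sum>\<^sub>\<infinity>n\<in>{1..}. v n) = (\<Sum>n. of_nat (Suc n) powr (-s))"
  proof -
    have "(v has_sum (infsum v UNIV)) UNIV"
      using abs_summable_summable[OF abs_summable_nat_powr[OF assms]] by (simp add: v_def[abs_def])
    hence "v sums (infsum v UNIV)" by (rule has_sum_imp_sums)
    hence "(\<lambda>n. v (Suc n)) sums (infsum v UNIV)"
      by (subst sums_Suc_iff) (simp add: v_def)
    moreover have "infsum v UNIV = infsum v {1..}"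
      by (rule infsum_cong_neutral) (auto simp: v_def not_le)
    ultimately show ?thesis by (simp add: sums_iff v_def[abs_def])
  qed
  ultimately show ?thesis using zeta_pole_eq[OF assms] by (simp add: mult_ac)
qed

section \<open>Non-vanishing on the line Re s = 1\<close>

text \<open>Unconditional sums may be evaluated along any finite sets that eventually contain each
  point. Here these are squares of pairs, initial segments, and the numbers built from small
  primes.\<close>

lemma has_sum_tendsto_exhaustion:
  assumes "(f has_sum S) A" "\<And>N::nat. finite (B N)" "\<And>N. B N \<subseteq> A"
    and "\<And>x. x \<in> A \<Longrightarrow> eventually (\<lambda>N. x \<in> B N) sequentially"
  shows "(\<lambda>N. sum f (B N)) \<longlonglongrightarrow> S"
proof -
  have "filterlim B (finite_subsets_at_top A) sequentially"
    unfolding filterlim_finite_subsets_at_top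
  proof (intro allI impI)
    fix X assume X: "finite X \<and> X \<subseteq> A"
    hence "eventually (\<lambda>N. \<forall>x\<in>X. x \<in> B N) sequentially"
      using assms(4) by (intro eventually_ball_finite) auto
    thus "eventually (\<lambda>N. finite (B N) \<and> X \<subseteq> B N \<and> B N \<subseteq> A) sequentially"
      by eventually_elim (use assms(2,3) in auto)
  qed
  with assms(1) show ?thesis
    unfolding has_sum_def by (rule filterlim_compose)
qed

lemma prime_factors_prod_primes:
  assumes "finite A" "\<And>p. p \<in> A \<Longrightarrow> prime (p :: nat)"
  shows "prime_factors (\<Prod>A) = A"
proof -
  have "prime_factors (\<Prod>p\<in>A. p) = \<Union> ((prime_factors \<circ> (\<lambda>p. p)) ` A)"
    using assms by (intro prime_factors_prod) (auto dest: prime_gt_0_nat)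
  also have "\<dots> = A" using assms(2) by (auto simp: prime_prime_factors)
  finally show ?thesis by simp
qed

lemma squarefree_prod_primes:
  assumes "\<And>p. p \<in> A \<Longrightarrow> prime (p :: nat)"
  shows "squarefree (\<Prod>A)"
  using assms by (intro squarefree_prod_coprime) (auto intro: primes_coprime squarefree_prime)

lemma prod_prime_factors_squarefree:
  assumes "squarefree (n :: nat)"
  shows "\<Prod>(prime_factors n) = n"
proof -
  have n0: "n \<noteq> 0" using assms not_squarefree_0 by metis
  have "n = (\<Prod>p\<in>prime_factors n. p ^ multiplicity p n)"
    using n0 by (simp add: prime_factorization_nat)
  also have "\<dots> = (\<Prod>p\<in>prime_factors n. p)"
    using assms n0 by (intro prod.cong) (auto simp: squarefree_factorial_semiring')
  finally show ?thesis ..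
qed

text \<open>Expanding the finite product over primes up to N gives exactly the terms of the
  squarefree n with all prime factors up to N, indexed by sets of primes; these sets of n exhaust
  the squarefree numbers.\<close>

lemma Euler_product_moebius:
  assumes "Re s > 1"
  shows "(\<lambda>N. \<Prod>p | prime p \<and> p \<le> N. 1 - of_nat p powr (-s)) \<longlonglongrightarrow> moebius_series s"
proof -
  define f where "f n = of_real (moebius n) * of_nat n powr (-s)" for n
  define P where "P N = {p. prime p \<and> p \<le> (N::nat)}" for N
  define B where "B N = Prod ` Pow (P N)" for N
  have finP: "finite (P N)" for N unfolding P_def by (rule finite_subset[of _ "{..N}"]) auto
  have finA: "finite A" if "A \<in> Pow (P N)" for A N using that finP finite_subset by auto
  have primeA: "prime p" if "A \<in> Pow (P N)" "p \<in> A" for A N p using that by (auto simp: P_def)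
  have "(f has_sum moebius_series s) UNIV"
    unfolding f_def by (rule moebius_series_has_sum[OF assms])
  hence sum: "(f has_sum moebius_series s) {n. squarefree n}"
    by (subst has_sum_cong_neutral[where T = UNIV and g = f]) (auto simp: f_def moebius_def)
  have "(\<lambda>N. sum f (B N)) \<longlonglongrightarrow> moebius_series s"
  proof (rule has_sum_tendsto_exhaustion[OF sum])
    show "finite (B N)" for N unfolding B_def using finP by simp
    show "B N \<subseteq> {n. squarefree n}" for N
      unfolding B_def using primeA by (auto intro!: squarefree_prod_primes)
    fix n :: nat assume n: "n \<in> {n. squarefree n}"
    show "eventually (\<lambda>N. n \<in> B N) sequentially"
      using eventually_ge_at_top[of n]
    proof eventually_elim
      case (elim N)
      have "n > 0" using n by (auto intro: Nat.gr0I)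
      hence "prime_factors n \<subseteq> P N" using elim by (auto simp: P_def prime_factors_dvd dest: dvd_imp_le)
      moreover have "n = \<Prod>(prime_factors n)" using n prod_prime_factors_squarefree by auto
      ultimately show ?case unfolding B_def by blast
    qed
  qed
  moreover have "sum f (B N) = (\<Prod>p\<in>P N. 1 - of_nat p powr (-s))" for N
  proof -
    have inj: "inj_on Prod (Pow (P N))"
    proof (rule inj_onI)
      fix A C assume AC: "A \<in> Pow (P N)" "C \<in> Pow (P N)" "\<Prod>A = \<Prod>C"
      have "A = prime_factors (\<Prod>A)"
        using prime_factors_prod_primes[OF finA[OF AC(1)] primeA[OF AC(1)]] by simp
      also have "\<dots> = prime_factors (\<Prod>C)" by (simp only: AC(3))
      also have "\<dots> = C"
        using prime_factors_prod_primes[OF finA[OF AC(2)] primeA[OF AC(2)]] by simp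
      finally show "A = C" .
    qed
    have powr: "of_nat (\<Prod>A) powr (-s) = (\<Prod>p\<in>A. of_nat p powr (-s))" if "finite A" for A :: "nat set"
      using that by (induction A rule: finite_induct) (simp_all add: nat_powr_mult del: of_nat_mult of_nat_prod)
    have "sum f (B N) = (\<Sum>A\<in>Pow (P N). f (\<Prod>A))"
      unfolding B_def by (simp add: sum.reindex[OF inj])
    \<comment> \<open>The trailing product of ones puts the sum into the shape of the expansion of a
      product of differences.\<close>
    also have "\<dots> = (\<Sum>A\<in>Pow (P N). (-1) ^ card A * (\<Prod>p\<in>A. of_nat p powr (-s)) * (\<Prod>p\<in>P N - A. 1))"
    proof (rule sum.cong)
      fix A assume A: "A \<in> Pow (P N)"
      have "moebius (\<Prod>A) = (-1) ^ card A"
        using squarefree_prod_primes[OF primeA[OF A]] prime_factors_prod_primes[OF finA[OF A] primeA[OF A]]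
        by (simp add: moebius_def)
      thus "f (\<Prod>A) = (-1) ^ card A * (\<Prod>p\<in>A. of_nat p powr (-s)) * (\<Prod>p\<in>P N - A. 1)"
        unfolding f_def powr[OF finA[OF A]] by simp
    qed simp
    also have "\<dots> = (\<Prod>p\<in>P N. 1 - of_nat p powr (-s))"
      by (rule prod_diff_conv_sum[OF finP, symmetric])
    finally show ?thesis .
  qed
  ultimately show ?thesis by (simp add: P_def)
qed

text \<open>After taking logarithms, this is the inequality \<open>3 + 4 cos \<theta> + cos 2\<theta> = 2 (1 + cos \<theta>)\<^sup>2 \<ge> 0\<close>.\<close>

lemma three_four_one:
  fixes w :: complex
  assumes r: "0 \<le> r" "r < 1" and w: "norm w = 1"
  shows "norm (1 - of_real r :: complex) ^ 3 * norm (1 - of_real r * w) ^ 4 * norm (1 - of_real r * w\<^sup>2) \<le> 1"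
proof -
  have series: "(\<lambda>n. - (r ^ n / n * Re (u ^ n))) sums Re (Ln (1 - of_real r * u))"
    and exp: "norm (1 - of_real r * u) = exp (Re (Ln (1 - of_real r * u)))"
    if u: "norm u = 1" for u :: complex
  proof -
    have less: "norm (of_real r * u) < 1" using r u by (simp add: norm_mult)
    \<comment> \<open>The summand at n = 0 is a division by 0 and hence 0, so the logarithm series
      may start there.\<close>
    have "(\<lambda>n. - ((of_real r * u) ^ n) / of_nat n) sums Ln (1 - of_real r * u)"
      using Ln_series'[of "- (of_real r * u)"] less by simp
    moreover have "- ((of_real r * u) ^ n) / of_nat n = of_real (- (r ^ n / n)) * u ^ n" for n
      by (simp add: power_mult_distrib)
    ultimately have "(\<lambda>n. of_real (- (r ^ n / n)) * u ^ n) sums Ln (1 - of_real r * u)" by (simp only:)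
    from sums_Re[OF this]
    show "(\<lambda>n. - (r ^ n / n * Re (u ^ n))) sums Re (Ln (1 - of_real r * u))"
      by (simp only: Re_complex_of_real times_complex.sel Im_complex_of_real mult_zero_left diff_zero mult_minus_left)
    have "1 - of_real r * u \<noteq> 0" using less by auto
    thus "norm (1 - of_real r * u) = exp (Re (Ln (1 - of_real r * u)))"
      using norm_exp_eq_Re[of "Ln (1 - of_real r * u)"] by (metis exp_Ln)
  qed
  define L where "L u = Re (Ln (1 - of_real r * u))" for u
  have w2: "norm (w\<^sup>2) = 1" using w by (simp add: norm_power)
  have sumL: "(\<lambda>n. 3 * - (r ^ n / n * Re (1 ^ n)) + 4 * - (r ^ n / n * Re (w ^ n)) + - (r ^ n / n * Re ((w\<^sup>2) ^ n)))
          sums (3 * L 1 + 4 * L w + L (w\<^sup>2))"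
    unfolding L_def using w w2 by (intro sums_add sums_mult series) auto
  have leL: "3 * - (r ^ n / n * Re (1 ^ n)) + 4 * - (r ^ n / n * Re (w ^ n)) + - (r ^ n / n * Re ((w\<^sup>2) ^ n)) \<le> 0" for n
  proof -
    define u where "u = w ^ n"
    have "norm u = 1" using w by (simp add: u_def norm_power)
    hence "(Re u)\<^sup>2 + (Im u)\<^sup>2 = 1" by (simp add: cmod_def)
    moreover have "Re (u\<^sup>2) = (Re u)\<^sup>2 - (Im u)\<^sup>2" by (simp add: power2_eq_square)
    ultimately have "3 + 4 * Re u + Re (u\<^sup>2) = 2 * (1 + Re u)\<^sup>2"
      by (simp add: power2_eq_square algebra_simps)
    moreover have "3 * - (q * 1) + 4 * - (q * Re u) + - (q * Re (u\<^sup>2)) = - (q * (3 + 4 * Re u + Re (u\<^sup>2)))" for q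
      by (simp add: algebra_simps)
    moreover have "(w\<^sup>2) ^ n = u\<^sup>2" by (simp only: u_def power_mult[symmetric] mult.commute)
    ultimately have "3 * - (r ^ n / n * Re (1 ^ n)) + 4 * - (r ^ n / n * Re (w ^ n)) + - (r ^ n / n * Re ((w\<^sup>2) ^ n))
        = - (r ^ n / n * (2 * (1 + Re u)\<^sup>2))"
      by (simp only: power_one one_complex.sel u_def[symmetric])
    thus ?thesis using r by simp
  qed
  have "3 * L 1 + 4 * L w + L (w\<^sup>2) \<le> 0"
    by (rule sums_le[OF leL sumL sums_zero])
  hence "exp (3 * L 1 + 4 * L w + L (w\<^sup>2)) \<le> 1" by simp
  moreover have "norm (1 - of_real r :: complex) = exp (L 1)" using exp[of 1] by (simp add: L_def)
  moreover have "norm (1 - of_real r * w) = exp (L w)" "norm (1 - of_real r * w\<^sup>2) = exp (L (w\<^sup>2))"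
    using exp[OF w] exp[OF w2] by (simp_all only: L_def)
  moreover have "exp (3 * L 1 + 4 * L w + L (w\<^sup>2)) = exp (L 1) ^ 3 * exp (L w) ^ 4 * exp (L (w\<^sup>2))"
    using exp_of_nat_mult[of 3 "L 1"] exp_of_nat_mult[of 4 "L w"] by (simp only: exp_add of_nat_numeral)
  ultimately show ?thesis by simp
qed

text \<open>The inequality holds for each Euler factor, with r = p^(-\<sigma>) and w = p^(-it), and
  survives the limit over finite products. For 1/zeta it is an upper bound.\<close>

lemma moebius_series_three_four_one:
  assumes "\<sigma> > 1"
  shows "norm (moebius_series (of_real \<sigma>)) ^ 3 * norm (moebius_series (Complex \<sigma> t)) ^ 4 *
         norm (moebius_series (Complex \<sigma> (2 * t))) \<le> 1"
proof -
  define E where "E s N = (\<Prod>p | prime p \<and> p \<le> N. 1 - of_nat p powr (-s))" for s :: complex and N :: nat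
  have lim: "E s \<longlonglongrightarrow> moebius_series s" if "Re s > 1" for s
    unfolding E_def using Euler_product_moebius[OF that] .
  have lim341: "(\<lambda>N. norm (E (of_real \<sigma>) N) ^ 3 * norm (E (Complex \<sigma> t) N) ^ 4 * norm (E (Complex \<sigma> (2 * t)) N))
     \<longlonglongrightarrow> norm (moebius_series (of_real \<sigma>)) ^ 3 * norm (moebius_series (Complex \<sigma> t)) ^ 4 *
         norm (moebius_series (Complex \<sigma> (2 * t)))"
    using assms by (intro tendsto_intros lim) auto
  have "norm (E (of_real \<sigma>) N) ^ 3 * norm (E (Complex \<sigma> t) N) ^ 4 * norm (E (Complex \<sigma> (2 * t)) N) \<le> 1" for N
  proof -
    have "norm (E (of_real \<sigma>) N) ^ 3 * norm (E (Complex \<sigma> t) N) ^ 4 * norm (E (Complex \<sigma> (2 * t)) N) =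
      (\<Prod>p | prime p \<and> p \<le> N. norm (1 - of_nat p powr (- of_real \<sigma>) :: complex) ^ 3 *
         norm (1 - of_nat p powr (- Complex \<sigma> t)) ^ 4 * norm (1 - of_nat p powr (- Complex \<sigma> (2 * t))))"
      unfolding E_def by (simp add: prod_norm prod.distrib flip: prod_power_distrib)
    also have "\<dots> \<le> (\<Prod>p | prime p \<and> p \<le> N. 1)"
    proof (rule prod_mono, intro conjI)
      fix p assume p: "p \<in> {p. prime p \<and> p \<le> N}"
      hence p1: "p > 1" using prime_gt_1_nat by auto
      define r where "r = real p powr (-\<sigma>)"
      define w where "w = of_nat p powr (- \<i> * of_real t)"
      have r: "0 \<le> r" "r < 1" using p1 assms by (auto simp: r_def powr_less_one)
      have w: "norm w = 1" unfolding w_def norm_nat_powr using p1 by simp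
      have e0: "of_nat p powr (- of_real \<sigma>) = (of_real r :: complex)"
        unfolding r_def by (subst powr_of_real[symmetric]) auto
      have "- Complex \<sigma> t = - of_real \<sigma> + (- \<i> * of_real t)" by (simp add: complex_eq_iff)
      hence e1: "of_nat p powr (- Complex \<sigma> t) = of_real r * w"
        unfolding w_def e0[symmetric] by (simp only: powr_add)
      have "- Complex \<sigma> (2 * t) = - of_real \<sigma> + (- \<i> * of_real t + - \<i> * of_real t)" by (simp add: complex_eq_iff)
      hence e2: "of_nat p powr (- Complex \<sigma> (2 * t)) = of_real r * w\<^sup>2"
        unfolding w_def e0[symmetric] power2_eq_square by (simp only: powr_add)
      show "norm (1 - of_nat p powr (- of_real \<sigma>) :: complex) ^ 3 *
         norm (1 - of_nat p powr (- Complex \<sigma> t)) ^ 4 * norm (1 - of_nat p powr (- Complex \<sigma> (2 * t))) \<le> 1"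
        unfolding e0 e1 e2 by (rule three_four_one[OF r w])
    qed auto
    finally show ?thesis by simp
  qed
  thus ?thesis by (intro LIMSEQ_le_const2[OF lim341]) auto
qed

text \<open>
  A zero at \<open>1 + it\<close> would make \<open>1/\<zeta>\<close> at \<open>1 + it + e\<close> at least of order \<open>1/e\<close>, so the product in the 3-4-1
  inequality would be of order at least \<open>e\<^sup>3 / e\<^sup>4\<close>.
\<close>

lemma zeta_pole_nonzero:
  assumes "Re s \<ge> 1"
  shows "zeta_pole s \<noteq> 0"
proof
  assume zero: "zeta_pole s = 0"
  show False
  proof (cases "Re s > 1")
    case True
    with zero moebius_series_mult_zeta_pole[OF True] show False by auto
  next
    case False
    define t where "t = Im s"
    have s: "s = Complex 1 t" using False assms by (simp add: t_def complex_eq_iff)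
    have t: "t \<noteq> 0"
    proof
      assume "t = 0"
      hence "s = 1" by (simp add: s complex_eq_iff)
      with zero show False by simp
    qed
    have diff: "zeta_pole field_differentiable at z" if "Re z > 0" for z
      using holomorphic_zeta_pole that
      by (intro holomorphic_on_imp_differentiable_at) (auto simp: open_halfspace_Re_gt)
    have cont: "isCont zeta_pole z" if "Re z > 0" for z
      using field_differentiable_imp_continuous_at[OF diff[OF that]] .
    have shift: "filterlim (\<lambda>e. z + of_real e) (nhds z) (at_right 0)" for z :: complex
      by (auto intro!: tendsto_eq_intros)
    have lim: "((\<lambda>e. zeta_pole (z + of_real e)) \<longlongrightarrow> zeta_pole z) (at_right 0)" if "Re z > 0" for z
      using isCont_tendsto_compose[OF cont[OF that] shift] .
    obtain D where "(zeta_pole has_field_derivative D) (at s)"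
      using diff[of s] by (auto simp: field_differentiable_def s)
    hence "((\<lambda>h. zeta_pole (s + h) / h) \<longlongrightarrow> D) (at 0)"
      using zero by (simp add: DERIV_def)
    moreover have "filterlim (\<lambda>e::real. of_real e :: complex) (at 0) (at_right 0)"
      unfolding filterlim_at by (auto intro!: tendsto_eq_intros simp: eventually_at_filter)
    ultimately have limD: "((\<lambda>e::real. zeta_pole (s + of_real e) / of_real e) \<longlongrightarrow> D) (at_right 0)"
      by (rule filterlim_compose)
    \<comment> \<open>The powers of e are distributed so that every factor has a limit: four
      complete the difference quotients at the zero, three are cancelled by the pole at 1, and the
      one left over forces the limit 0. The other side of the inequality tends to 2|t|^5.\<close>
    have "((\<lambda>e::real. norm (zeta_pole (1 + of_real e)) ^ 3 * norm (zeta_pole (s + of_real e) / of_real e) ^ 4 *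
             (e * norm (zeta_pole (Complex 1 (2 * t) + of_real e))))
            \<longlongrightarrow> norm (zeta_pole 1) ^ 3 * norm D ^ 4 * (0 * norm (zeta_pole (Complex 1 (2 * t))))) (at_right 0)"
      by (intro tendsto_intros lim limD) auto
    moreover have "((\<lambda>e::real. norm (\<i> * of_real t + of_real e) ^ 4 * norm (\<i> * of_real (2 * t) + of_real e)) \<longlongrightarrow>
                norm (\<i> * of_real t) ^ 4 * norm (\<i> * of_real (2 * t))) (at_right 0)"
      by (intro tendsto_intros shift)
    moreover have "eventually (\<lambda>e::real. norm (\<i> * of_real t + of_real e) ^ 4 * norm (\<i> * of_real (2 * t) + of_real e)
        \<le> norm (zeta_pole (1 + of_real e)) ^ 3 * norm (zeta_pole (s + of_real e) / of_real e) ^ 4 *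
             (e * norm (zeta_pole (Complex 1 (2 * t) + of_real e)))) (at_right 0)"
      using eventually_at_right_less[of 0]
    proof eventually_elim
      case (elim e)
      define z0 z1 z2 where "z0 = (1 + of_real e :: complex)" and "z1 = s + of_real e"
        and "z2 = Complex 1 (2 * t) + of_real e"
      define M where "M = moebius_series"
      have z: "z0 = of_real (1 + e)" "z1 = Complex (1 + e) t" "z2 = Complex (1 + e) (2 * t)"
        by (simp_all add: z0_def z1_def z2_def s complex_eq_iff)
      have ineq: "norm (M z0) ^ 3 * norm (M z1) ^ 4 * norm (M z2) \<le> 1"
        unfolding z M_def using elim by (intro moebius_series_three_four_one) auto
      have eqs: "norm (M z0) * norm (zeta_pole z0) = e"
        "norm (M z1) * norm (zeta_pole z1) = norm (\<i> * of_real t + of_real e)"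
        "norm (M z2) * norm (zeta_pole z2) = norm (\<i> * of_real (2 * t) + of_real e)"
      proof -
        have "z0 - 1 = of_real e" "z1 - 1 = \<i> * of_real t + of_real e" "z2 - 1 = \<i> * of_real (2 * t) + of_real e"
          by (simp_all add: z complex_eq_iff)
        moreover have "Re z0 > 1" "Re z1 > 1" "Re z2 > 1" using elim by (simp_all add: z)
        ultimately show "norm (M z0) * norm (zeta_pole z0) = e"
          "norm (M z1) * norm (zeta_pole z1) = norm (\<i> * of_real t + of_real e)"
          "norm (M z2) * norm (zeta_pole z2) = norm (\<i> * of_real (2 * t) + of_real e)"
          using elim unfolding norm_mult[symmetric] M_def
          by (simp_all only: moebius_series_mult_zeta_pole norm_of_real)
      qed
      define a0 a1 a2 where "a0 = norm (zeta_pole z0)" and "a1 = norm (zeta_pole z1)" and "a2 = norm (zeta_pole z2)"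
      have nn: "a0 \<ge> 0" "a1 \<ge> 0" "a2 \<ge> 0" by (simp_all add: a0_def a1_def a2_def)
      have "e ^ 3 * (norm (\<i> * of_real t + of_real e) ^ 4 * norm (\<i> * of_real (2 * t) + of_real e)) =
            (norm (M z0) ^ 3 * norm (M z1) ^ 4 * norm (M z2)) * (a0 ^ 3 * a1 ^ 4 * a2)"
        unfolding eqs(2,3)[symmetric] a0_def a1_def a2_def
        by (subst (1) eqs(1)[symmetric]) (simp add: power_mult_distrib mult_ac)
      also have "\<dots> \<le> 1 * (a0 ^ 3 * a1 ^ 4 * a2)"
        using nn by (intro mult_right_mono ineq) auto
      also have "\<dots> = e ^ 3 * (a0 ^ 3 * (a1 / e) ^ 4 * (e * a2))"
        using elim by (simp add: power_divide field_simps eval_nat_numeral)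
      finally have "norm (\<i> * of_real t + of_real e) ^ 4 * norm (\<i> * of_real (2 * t) + of_real e)
          \<le> a0 ^ 3 * (a1 / e) ^ 4 * (e * a2)"
        using elim by simp
      thus ?case using elim by (simp add: a0_def a1_def a2_def z0_def z1_def z2_def norm_divide)
    qed
    ultimately have "norm (\<i> * of_real t) ^ 4 * norm (\<i> * of_real (2 * t)) \<le>
       norm (zeta_pole 1) ^ 3 * norm D ^ 4 * (0 * norm (zeta_pole (Complex 1 (2 * t))))"
      by (intro tendsto_le[of "at_right 0"]) auto
    hence "\<bar>t\<bar> ^ 4 * (2 * \<bar>t\<bar>) \<le> 0" by (simp add: norm_mult abs_mult)
    moreover have "\<bar>t\<bar> ^ 4 * (2 * \<bar>t\<bar>) > 0" using t by simp
    ultimately show False by linarith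
  qed
qed

text \<open>\<open>G\<close> continues 1/zeta across the line Re s = 1, and
  \<open>zeta_pole 1 = 1\<close> makes its value at 1 equal to 0.\<close>

theorem moebius_over_n_tendsto_0: "(\<lambda>N. \<Sum>n=1..N. moebius n / real n) \<longlonglongrightarrow> 0"
proof -
  define G where "G s = (s - 1) / zeta_pole s" for s
  define U where "U = {s. Re s > 0} \<inter> zeta_pole -` (- {0})"
  have "open U"
    unfolding U_def using holomorphic_on_imp_continuous_on[OF holomorphic_zeta_pole]
    by (intro continuous_open_preimage) (auto simp: open_halfspace_Re_gt)
  moreover have "{s. Re s \<ge> 1} \<subseteq> U" using zeta_pole_nonzero by (auto simp: U_def)
  moreover have "G holomorphic_on U"
    unfolding G_def
    by (intro holomorphic_intros holomorphic_on_subset[OF holomorphic_zeta_pole]) (auto simp: U_def)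
  moreover have "(\<lambda>n. of_real (moebius n) * of_nat n powr (-s)) sums G s" if "Re s > 1" for s
  proof -
    have "moebius_series s = G s"
      using moebius_series_mult_zeta_pole[OF that] zeta_pole_nonzero[of s] that
      by (simp add: G_def field_simps)
    thus ?thesis using has_sum_imp_sums[OF moebius_series_has_sum[OF that]] by simp
  qed
  ultimately have "(\<lambda>N. \<Sum>n=1..N. of_real (moebius n) / of_nat n) \<longlonglongrightarrow> G 1"
    by (intro Newman_tauberian[where U = U]) (auto simp: abs_moebius_le_1)
  moreover have "G 1 = of_real 0" by (simp add: G_def)
  moreover have "(\<Sum>n=1..N. of_real (moebius n) / of_nat n) = (of_real (\<Sum>n=1..N. moebius n / real n) :: complex)" for N
    by simp
  ultimately show ?thesis by (simp only: tendsto_of_real_iff)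
qed

section \<open>Values of absolutely convergent sums\<close>

text \<open>The sine product at the imaginary argument \<i> x; taking imaginary parts returns it to
  the reals.\<close>

lemma sinh_product_formula_real:
  assumes "x \<noteq> (0::real)"
  shows "(\<lambda>n. (\<Prod>k=1..n. 1 + x^2 / of_nat k^2)) \<longlonglongrightarrow> sinh (pi * x) / (pi * x)"
proof -
  have "(\<lambda>n. of_real pi * (\<i> * of_real x) * (\<Prod>k=1..n. 1 - (\<i> * of_real x)^2 / of_nat k^2)) \<longlonglongrightarrow>
          sin (of_real pi * (\<i> * of_real x))"
    by (rule sin_product_formula_complex)
  moreover have "sin (of_real pi * (\<i> * of_real x)) = \<i> * of_real (sinh (pi * x))"
  proof -
    define c where "c = complex_of_real (pi * x)"
    have "of_real (sinh (pi * x)) = (exp c - exp (-c)) / 2"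
      by (simp add: c_def sinh_field_def flip: exp_of_real)
    moreover have "sin (\<i> * c) = (exp (-c) - exp c) / (2 * \<i>)"
      by (simp add: sin_exp_eq flip: mult.assoc)
    moreover have "of_real pi * (\<i> * of_real x) = \<i> * c" by (simp add: c_def)
    moreover have "(u - v) / (2 * \<i>) = \<i> * ((v - u) / 2)" for u v :: complex
      by (rule nonzero_divide_eq_eq[THEN iffD2]) (simp_all add: algebra_simps)
    ultimately show ?thesis by (simp only:)
  qed
  moreover have "(\<Prod>k=1..n. 1 - (\<i> * of_real x)^2 / of_nat k^2) = (of_real (\<Prod>k=1..n. 1 + x^2 / of_nat k^2) :: complex)" for n
    by (simp add: power_mult_distrib)
  ultimately have "(\<lambda>n. of_real pi * (\<i> * of_real x) * of_real (\<Prod>k=1..n. 1 + x^2 / of_nat k^2)) \<longlonglongrightarrow>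
      \<i> * of_real (sinh (pi * x))" by simp
  hence "(\<lambda>n. Im (of_real pi * (\<i> * of_real x) * of_real (\<Prod>k=1..n. 1 + x^2 / of_nat k^2))) \<longlonglongrightarrow>
      Im (\<i> * of_real (sinh (pi * x)))"
    by (rule tendsto_Im)
  hence "(\<lambda>n. pi * x * (\<Prod>k=1..n. 1 + x^2 / of_nat k^2)) \<longlonglongrightarrow> sinh (pi * x)"
    by (simp del: of_real_prod)
  from tendsto_divide[OF this tendsto_const[of "pi * x"]] assms show ?thesis by simp
qed

text \<open>
  Multiplying the products for \<open>sin\<close> and \<open>sinh\<close> gives the product of \<open>1 - x\<^sup>4/k\<^sup>4\<close>; the value of the sum
  is read off from its expansion at 0.
\<close>

theorem inverse_fourth_powers_sums: "(\<lambda>n. 1 / real (Suc n) ^ 4) sums (pi ^ 4 / 90)"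
proof -
  define P where "P x n = (\<Prod>k=1..n. 1 - x^4 / of_nat k^4)" for x :: real and n
  define g where "g x = (1 - sin (pi * x) * sinh (pi * x) / (pi * x)\<^sup>2) / x ^ 4" for x
  \<comment> \<open>Consecutive partial products differ by x^4 * P x n / (n+1)^4, so for x \<noteq>
    0 this series telescopes to (1 - infinite product) / x^4, while at x = 0 it is the sum
    sought.\<close>
  define f where "f x = (\<Sum>n. P x n / real (Suc n) ^ 4)" for x
  have summ: "summable (\<lambda>n. 1 / real (Suc n) ^ 4)"
    using inverse_power_summable[of 4, where ?'a = real] summable_Suc_iff[of "\<lambda>n. inverse (real n ^ 4)"]
    by (simp add: inverse_eq_divide)
  have f_eq: "f x = g x" if "x \<noteq> 0" for x
  proof -
    have "(\<lambda>n. (\<Prod>k=1..n. 1 - x^2 / of_nat k^2) * (\<Prod>k=1..n. 1 + x^2 / of_nat k^2)) \<longlonglongrightarrow>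
             (sin (pi * x) / (pi * x)) * (sinh (pi * x) / (pi * x))"
      by (intro tendsto_mult sin_product_formula_real' sinh_product_formula_real that)
    moreover have "(\<Prod>k=1..n. 1 - x^2 / of_nat k^2) * (\<Prod>k=1..n. 1 + x^2 / of_nat k^2) = P x n" for n
      unfolding P_def prod.distrib[symmetric]
      by (intro prod.cong) (auto simp: field_simps eval_nat_numeral)
    ultimately have "(\<lambda>n. P x n) \<longlonglongrightarrow> sin (pi * x) * sinh (pi * x) / (pi * x)\<^sup>2"
      by (simp add: power2_eq_square)
    hence "(\<lambda>n. P x n - P x (Suc n)) sums (P x 0 - sin (pi * x) * sinh (pi * x) / (pi * x)\<^sup>2)"
      by (rule telescope_sums')
    moreover have "P x n - P x (Suc n) = x ^ 4 * (P x n / real (Suc n) ^ 4)" for n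
      unfolding P_def by (simp add: prod.nat_ivl_Suc' algebra_simps)
    ultimately have "(\<lambda>n. x ^ 4 * (P x n / real (Suc n) ^ 4)) sums
         (P x 0 - sin (pi * x) * sinh (pi * x) / (pi * x)\<^sup>2)" by simp
    from sums_divide[OF this, of "x ^ 4"] show ?thesis
      using that by (simp add: f_def g_def P_def sums_iff)
  qed
  \<comment> \<open>For |x| < 1 all factors have absolute value at most 1, so the series at 0 is
    itself a uniform majorant. Continuity then identifies \<open>f 0\<close> with the limit of
    \<open>g\<close>, where sin y sinh y / y^2 = 1 - y^4/90 + ...\<close>
  have "continuous_on (ball 0 1) f"
  proof (rule uniform_limit_theorem)
    show "uniform_limit (ball 0 1) (\<lambda>n x. \<Sum>k<n. P x k / real (Suc k) ^ 4) f sequentially"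
      unfolding f_def
    proof (rule Weierstrass_m_test[OF _ summ])
      fix n :: nat and x :: real assume x: "x \<in> ball 0 1"
      have "\<bar>1 - x^4 / of_nat k^4\<bar> \<le> 1" if "k \<ge> 1" for k :: nat
      proof -
        have "\<bar>x\<bar> ^ 4 \<le> 1" using x by (intro power_le_one) auto
        moreover have "1 \<le> real k ^ 4" using that by simp
        ultimately have "x ^ 4 / real k ^ 4 \<le> 1" by (simp add: divide_le_eq)
        moreover have "x ^ 4 / real k ^ 4 \<ge> 0" by simp
        ultimately show ?thesis by (simp only: abs_le_iff) linarith
      qed
      hence "(\<Prod>k=1..n. \<bar>1 - x^4 / of_nat k^4\<bar>) \<le> (\<Prod>k=1..n. 1)"
        by (intro prod_mono) auto
      thus "norm (P x n / real (Suc n) ^ 4) \<le> 1 / real (Suc n) ^ 4"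
        by (simp add: P_def abs_prod divide_right_mono del: of_nat_Suc)
    qed
  qed (auto simp: P_def intro!: always_eventually continuous_intros)
  hence "isCont f 0" by (subst (asm) continuous_on_eq_continuous_at) simp_all
  hence "f \<midarrow>0\<rightarrow> f 0" by (simp add: isCont_def)
  moreover have "f \<midarrow>0\<rightarrow> pi ^ 4 / 90"
  proof (rule Lim_transform_eventually)
    have "(\<lambda>y::real. (1 - sin y * sinh y / y\<^sup>2) / y ^ 4) \<midarrow>0\<rightarrow> 1 / 90"
      unfolding sinh_field_def by real_asymp
    moreover have "filterlim (\<lambda>x. pi * x) (at 0) (at 0)"
      by (auto simp: filterlim_at eventually_at_filter intro!: tendsto_eq_intros)
    ultimately have "(\<lambda>x. (1 - sin (pi * x) * sinh (pi * x) / (pi * x)\<^sup>2) / (pi * x) ^ 4) \<midarrow>0\<rightarrow> 1 / 90"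
      by (rule filterlim_compose)
    hence "(\<lambda>x. pi ^ 4 * ((1 - sin (pi * x) * sinh (pi * x) / (pi * x)\<^sup>2) / (pi * x) ^ 4)) \<midarrow>0\<rightarrow> pi ^ 4 * (1 / 90)"
      by (intro tendsto_mult tendsto_const)
    thus "g \<midarrow>0\<rightarrow> pi ^ 4 / 90"
      by (simp add: g_def[abs_def] power_mult_distrib)
    show "eventually (\<lambda>x. g x = f x) (at 0)"
      using f_eq by (auto simp: eventually_at_filter)
  qed
  ultimately have "f 0 = pi ^ 4 / 90" by (rule LIM_unique)
  moreover have "f 0 = (\<Sum>n. 1 / real (Suc n) ^ 4)" by (simp add: f_def P_def del: of_nat_Suc)
  ultimately show ?thesis using summ by (simp add: sums_iff)
qed

lemma has_sum_atLeast_1: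
  fixes f :: "nat \<Rightarrow> real"
  assumes "(\<lambda>n. f (Suc n)) sums S" "\<And>n. f n \<ge> 0"
  shows "(f has_sum S) {1..}"
proof -
  have "((\<lambda>n. f (Suc n)) has_sum S) UNIV"
    using assms by (intro sums_nonneg_imp_has_sum) auto
  moreover have "bij_betw Suc UNIV {1..}"
    by (rule bij_betwI[where g = "\<lambda>n. n - 1"]) auto
  ultimately show ?thesis using has_sum_reindex_bij_betw by blast
qed

lemma inverse_squares_has_sum: "((\<lambda>n. 1 / (real n)\<^sup>2) has_sum (pi\<^sup>2 / 6)) {1..}"
  using inverse_squares_sums by (intro has_sum_atLeast_1) (auto simp: add_ac)

lemma inverse_fourth_powers_has_sum: "((\<lambda>n. 1 / (real n) ^ 4) has_sum (pi ^ 4 / 90)) {1..}"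
  using inverse_fourth_powers_sums by (intro has_sum_atLeast_1) auto

lemma norm_inverse_squares_summable: "(\<lambda>n. norm (1 / (real n)\<^sup>2)) summable_on {1..}"
  using inverse_squares_has_sum by (simp add: has_sum_imp_summable)

lemma infsum_moebius_over_square: "(\<Sum>\<^sub>\<infinity>n\<in>{1..}. moebius n / (real n)\<^sup>2) = 6 / pi\<^sup>2"
proof -
  have "(\<Sum>\<^sub>\<infinity>n\<in>{1..}. of_real (moebius n) * (1 / (real n)\<^sup>2)) * (\<Sum>\<^sub>\<infinity>n\<in>{1..}. 1 / (real n)\<^sup>2) = 1"
    by (intro moebius_convolution_infsum norm_inverse_squares_summable) (auto simp: power_mult_distrib)
  moreover have "(\<Sum>\<^sub>\<infinity>n\<in>{1..}. 1 / (real n)\<^sup>2) = pi\<^sup>2 / 6"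
    using inverse_squares_has_sum by (rule infsumI)
  ultimately have "(\<Sum>\<^sub>\<infinity>n\<in>{1..}. moebius n * (1 / (real n)\<^sup>2)) * (pi\<^sup>2 / 6) = 1"
    by (simp only: of_real_eq_id id_apply)
  thus ?thesis by (simp add: field_simps)
qed

text \<open>If x^2 divides a b^2, divide x and b by their gcd: the square of the reduced x divides
  the squarefree a, so the reduced x is 1 and x divides b.\<close>

lemma square_part_unique:
  assumes "squarefree a" "b > 0"
  shows "square_part (a * b\<^sup>2) = (b::nat)"
proof -
  have "x dvd b" if x: "x\<^sup>2 dvd a * b\<^sup>2" for x
  proof -
    obtain x' b' where xb: "x = x' * gcd x b" "b = b' * gcd x b" "coprime x' b'"
      using gcd_coprime_exists[of x b] assms(2) by auto
    define g where "g = gcd x b"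
    have g: "g > 0" using assms(2) by (simp add: g_def)
    have "(x' * g)\<^sup>2 dvd a * (b' * g)\<^sup>2" using x xb unfolding g_def by metis
    hence "x'\<^sup>2 * g\<^sup>2 dvd (a * b'\<^sup>2) * g\<^sup>2" by (simp only: power_mult_distrib mult_ac)
    hence "x'\<^sup>2 dvd a * b'\<^sup>2" using g by simp
    moreover have "coprime (x'\<^sup>2) (b'\<^sup>2)" using xb(3) by simp
    ultimately have "x'\<^sup>2 dvd a" by (simp add: coprime_dvd_mult_left_iff)
    hence "x' = 1" using squarefreeD[OF assms(1), of x'] by simp
    with xb(1) show "x dvd b" by (metis gcd_dvd2 mult_1)
  qed
  hence "square_part (a * b\<^sup>2) dvd b" by blast
  moreover have "b dvd square_part (a * b\<^sup>2)" by (simp add: dvd_square_part_iff)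
  ultimately show ?thesis by (rule dvd_antisym)
qed

text \<open>The square of mu is the indicator of squarefree numbers. Writing n = a b^2 uniquely with
  a squarefree factors zeta(2) as the sum in question times zeta(4).\<close>

lemma moebius_square_over_square_has_sum:
  "((\<lambda>n. (moebius n)\<^sup>2 / (real n)\<^sup>2) has_sum (15 / pi\<^sup>2)) {1..}"
proof -
  define SF where "SF = {a::nat. squarefree a}"
  have SF0: "a \<ge> 1" if "a \<in> SF" for a using that not_squarefree_0 by (cases a) (auto simp: SF_def)
  have bij: "bij_betw (\<lambda>(a, b). a * b\<^sup>2) (SF \<times> {1..}) {1::nat..}"
  proof (rule bij_betwI[where g = "\<lambda>n. (squarefree_part n, square_part n)"])
    show "(\<lambda>(a, b). a * b\<^sup>2) \<in> SF \<times> {1..} \<rightarrow> {1..}" using SF0 by (force simp: Suc_le_eq)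
    show "(\<lambda>n. (squarefree_part n, square_part n)) \<in> {1..} \<rightarrow> SF \<times> {1..}"
      by (auto simp: SF_def Suc_le_eq intro!: Nat.gr0I)
    show "(case (squarefree_part n, square_part n) of (a, b) \<Rightarrow> a * b\<^sup>2) = n" for n :: nat
      by (simp flip: squarefree_decompose)
    fix p assume p: "p \<in> SF \<times> {1::nat..}"
    then obtain a b where ab: "p = (a, b)" "squarefree a" "b > 0" by (auto simp: SF_def)
    have sq: "square_part (a * b\<^sup>2) = b" using ab by (intro square_part_unique)
    have "squarefree_part (a * b\<^sup>2) * b\<^sup>2 = a * b\<^sup>2"
      by (rule squarefree_decompose[of "a * b\<^sup>2", unfolded sq, symmetric])
    with ab sq show "(squarefree_part (case p of (a, b) \<Rightarrow> a * b\<^sup>2), square_part (case p of (a, b) \<Rightarrow> a * b\<^sup>2)) = p"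
      by simp
  qed
  have sumSF: "(\<lambda>a. norm (1 / (real a)\<^sup>2)) summable_on SF"
    by (rule summable_on_subset_banach[OF norm_inverse_squares_summable]) (use SF0 in auto)
  have sum4: "(\<lambda>a. norm (1 / (real a) ^ 4)) summable_on {1..}"
    using inverse_fourth_powers_has_sum by (simp add: has_sum_imp_summable)
  have "((\<lambda>n. 1 / (real n)\<^sup>2) has_sum (pi\<^sup>2 / 6)) {1..}" by (rule inverse_squares_has_sum)
  hence "((\<lambda>p. 1 / (real ((\<lambda>(a, b). a * b\<^sup>2) p))\<^sup>2) has_sum (pi\<^sup>2 / 6)) (SF \<times> {1..})"
    by (subst has_sum_reindex_bij_betw[OF bij])
  also have "(\<lambda>p. 1 / (real ((\<lambda>(a, b). a * b\<^sup>2) p))\<^sup>2) = (\<lambda>(a, b). 1 / (real a)\<^sup>2 * (1 / real b ^ 4))"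
    by (auto simp: fun_eq_iff power_mult_distrib simp flip: power_mult)
  finally have "((\<lambda>(a, b). 1 / (real a)\<^sup>2 * (1 / real b ^ 4)) has_sum (pi\<^sup>2 / 6)) (SF \<times> {1..})" .
  moreover note has_sum_product_abs(1)[OF sumSF sum4]
  ultimately have "(\<Sum>\<^sub>\<infinity>a\<in>SF. 1 / (real a)\<^sup>2) * (\<Sum>\<^sub>\<infinity>b\<in>{1..}. 1 / real b ^ 4) = pi\<^sup>2 / 6"
    by (rule has_sum_unique[rotated])
  hence "(\<Sum>\<^sub>\<infinity>a\<in>SF. 1 / (real a)\<^sup>2) * (pi ^ 4 / 90) = pi\<^sup>2 / 6"
    by (simp only: infsumI[OF inverse_fourth_powers_has_sum])
  hence "(\<Sum>\<^sub>\<infinity>a\<in>SF. 1 / (real a)\<^sup>2) = 15 / pi\<^sup>2"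
    by (simp add: field_simps eval_nat_numeral)
  moreover have "(\<lambda>a. 1 / (real a)\<^sup>2) summable_on SF"
    using sumSF by (rule abs_summable_summable)
  ultimately have "((\<lambda>a. 1 / (real a)\<^sup>2) has_sum (15 / pi\<^sup>2)) SF" by (simp add: has_sum_iff)
  thus ?thesis
    by (rule has_sum_cong_neutral[THEN iffD1, rotated -1])
       (use SF0 in \<open>auto simp: SF_def moebius_def power_even_eq[symmetric] simp flip: power_mult\<close>)
qed

section \<open>The double sum with gcd(n,m)^2\<close>

definition gcd_term :: "nat \<Rightarrow> nat \<Rightarrow> real" where
  "gcd_term n m = moebius n * moebius m * (real (gcd n m))\<^sup>2 / ((real n)\<^sup>2 * (real m)\<^sup>2)"

text \<open>With d = gcd n m, n = d a, m = d b, the weight is 1/(d^2 a^2 b^2). The map to (d, a, b)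
  is injective, so forgetting that a and b are coprime leaves the majorant zeta(2)^3.\<close>

lemma gcd_term_abs_summable: "(\<lambda>(n, m). norm (gcd_term n m)) summable_on ({1..} \<times> {1..})"
proof -
  define h where "h = (\<lambda>(d, a, b). 1 / (real d)\<^sup>2 * (1 / (real a)\<^sup>2 * (1 / (real b)\<^sup>2)))"
  define \<iota> where "\<iota> = (\<lambda>(n::nat, m::nat). (gcd n m, n div gcd n m, m div gcd n m))"
  have inj: "inj_on \<iota> ({1..} \<times> {1..})"
  proof (rule inj_on_inverseI)
    show "(\<lambda>(d, a, b). (d * a, d * b)) (\<iota> p) = p" for p by (cases p) (simp add: \<iota>_def)
  qed
  have h_summable: "h summable_on ({1..} \<times> {1..} \<times> {1..})"
  proof -
    have *: "(\<lambda>x. norm ((\<lambda>(a, b). 1 / (real a)\<^sup>2 * (1 / (real b)\<^sup>2)) x)) summable_on ({1..} \<times> {1..})"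
      by (rule has_sum_product_abs(2)[OF norm_inverse_squares_summable norm_inverse_squares_summable])
    have "(\<lambda>(x, y). 1 / (real x)\<^sup>2 * (\<lambda>(a, b). 1 / (real a)\<^sup>2 * (1 / (real b)\<^sup>2)) y) summable_on
            ({1..} \<times> {1..} \<times> {1..})"
      by (rule has_sum_imp_summable[OF has_sum_product_abs(1)[OF norm_inverse_squares_summable *]])
    thus ?thesis by (simp add: h_def case_prod_unfold)
  qed
  have "h summable_on (\<iota> ` ({1..} \<times> {1..}))"
    by (rule summable_on_subset_banach[OF h_summable]) (auto simp: \<iota>_def Suc_le_eq div_greater_zero_iff intro!: gcd_le1_nat gcd_le2_nat)
  hence sum: "(h \<circ> \<iota>) summable_on ({1..} \<times> {1..})"
    by (subst (asm) summable_on_reindex[OF inj])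
  show ?thesis
  proof (rule summable_on_comparison_test[OF sum])
    fix p :: "nat \<times> nat" assume p: "p \<in> {1..} \<times> {1..}"
    then obtain n m where nm: "p = (n, m)" "n > 0" "m > 0" by auto
    define g where "g = gcd n m"
    obtain a b where ab: "n = g * a" "m = g * b" by (metis dvdE gcd_dvd1 gcd_dvd2 g_def)
    have pos: "g > 0" "a > 0" "b > 0" using nm ab by (auto intro: Nat.gr0I)
    have "(h \<circ> \<iota>) p = 1 / (real g)\<^sup>2 * (1 / (real a)\<^sup>2 * (1 / (real b)\<^sup>2))"
      using pos by (simp add: h_def \<iota>_def nm(1) flip: g_def) (simp add: ab)
    also have "\<dots> = (real g)\<^sup>2 / ((real n)\<^sup>2 * (real m)\<^sup>2)"
      using pos by (simp add: ab field_simps power2_eq_square)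
    finally have eq: "(h \<circ> \<iota>) p = (real g)\<^sup>2 / ((real n)\<^sup>2 * (real m)\<^sup>2)" .
    have "\<bar>moebius n\<bar> * \<bar>moebius m\<bar> * ((real g)\<^sup>2 / ((real n)\<^sup>2 * (real m)\<^sup>2)) \<le>
            1 * 1 * ((real g)\<^sup>2 / ((real n)\<^sup>2 * (real m)\<^sup>2))"
      by (intro mult_mono abs_moebius_le_1) auto
    thus "(case p of (n, m) \<Rightarrow> norm (gcd_term n m)) \<le> (h \<circ> \<iota>) p"
      unfolding eq by (simp add: gcd_term_def nm g_def abs_mult)
  qed auto
qed

text \<open>For a prime p dividing n but not m, passing from m to p m multiplies the gcd by p. The
  resulting p^2 in the numerator matches the one in the denominator, so only the sign of mu
  changes.\<close>

lemma gcd_term_inner_sum: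
  assumes "n > 1"
  shows "(\<Sum>\<^sub>\<infinity>m\<in>{1..}. gcd_term n m) = 0"
proof -
  obtain p where p: "prime p" "p dvd n" using prime_factor_nat[of n] assms by auto
  obtain k where k: "n = p * k" using p(2) by blast
  have p0: "p > 0" using p(1) prime_gt_0_nat by blast
  have neutral: "gcd_term n 0 = 0" by (simp add: gcd_term_def)
  have "infsum (gcd_term n) UNIV = 0"
  proof (rule infsum_cancel_prime_multiples[OF p(1)])
    have "(\<lambda>p. norm ((\<lambda>(n, m). gcd_term n m) p)) summable_on ({1..} \<times> {1..})"
      using gcd_term_abs_summable by (simp add: case_prod_unfold)
    hence "(\<lambda>(n, m). gcd_term n m) summable_on ({1..} \<times> {1..})"
      by (rule abs_summable_summable)
    hence "gcd_term n summable_on {1..}"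
      using assms summable_on_SigmaD1[of gcd_term "{1..}" "\<lambda>_. {1..}" n] by simp
    thus "gcd_term n summable_on UNIV"
      by (rule summable_on_cong_neutral[THEN iffD1, rotated -1]) (auto simp: neutral not_le)
    show "gcd_term n (p * m) = - gcd_term n m" if m: "\<not> p dvd m" for m
    proof -
      have "coprime m p" using p(1) m by (metis coprime_commute prime_imp_coprime)
      hence "gcd n m = gcd k m" unfolding k by (rule gcd_mult_left_left_cancel)
      moreover have "gcd n (p * m) = p * gcd k m" unfolding k by (simp add: gcd_mult_distrib_nat)
      ultimately have "gcd n (p * m) = p * gcd n m" by simp
      thus ?thesis using p0 moebius_prime_mult[OF p(1) m]
        by (simp add: gcd_term_def power_mult_distrib)
    qed
    show "gcd_term n (p * (p * m)) = 0" for m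
      using moebius_prime_square_mult[OF p(1)] by (simp add: gcd_term_def)
  qed
  also have "infsum (gcd_term n) UNIV = infsum (gcd_term n) {1..}"
    by (rule infsum_cong_neutral) (auto simp: neutral not_le)
  finally show ?thesis .
qed

lemma gcd_term_has_sum: "((\<lambda>(n, m). gcd_term n m) has_sum (6 / pi\<^sup>2)) ({1..} \<times> {1..})"
proof -
  have "(\<lambda>p. norm ((\<lambda>(n, m). gcd_term n m) p)) summable_on ({1..} \<times> {1..})"
    using gcd_term_abs_summable by (simp add: case_prod_unfold)
  hence summ: "(\<lambda>(n, m). gcd_term n m) summable_on ({1..} \<times> {1..})"
    by (rule abs_summable_summable)
  have "infsum (\<lambda>(n, m). gcd_term n m) ({1..} \<times> {1..}) = (\<Sum>\<^sub>\<infinity>n\<in>{1..}. \<Sum>\<^sub>\<infinity>m\<in>{1..}. gcd_term n m)"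
    using infsum_Sigma'_banach[OF summ] by simp
  also have "\<dots> = (\<Sum>\<^sub>\<infinity>n\<in>{1}. \<Sum>\<^sub>\<infinity>m\<in>{1..}. gcd_term n m)"
  proof (rule infsum_cong_neutral)
    fix n :: nat assume "n \<in> {1..} - {1}"
    thus "(\<Sum>\<^sub>\<infinity>m\<in>{1..}. gcd_term n m) = 0" by (intro gcd_term_inner_sum) auto
  qed auto
  also have "\<dots> = 6 / pi\<^sup>2"
    using infsum_moebius_over_square by (simp add: gcd_term_def)
  finally show ?thesis using summ by (simp add: has_sum_iff)
qed

section \<open>Correlations of fractional parts\<close>

lemma integrable_on_Icc_bounded_borel:
  fixes f :: "real \<Rightarrow> real"
  assumes "f \<in> borel_measurable borel" "\<And>x. \<bar>f x\<bar> \<le> B"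
  shows "f integrable_on {a..b}"
proof (rule measurable_bounded_by_integrable_imp_integrable[where g = "\<lambda>_. B"])
  show "f \<in> borel_measurable (lebesgue_on {a..b})"
    using assms(1) by (intro measurable_restrict_space1 measurable_completion) simp
qed (use assms(2) in auto)

lemma periodic_of_nat:
  assumes "\<And>x::real. f (x + 1) = f x"
  shows "f (x + real k) = f x"
proof (induction k)
  case (Suc k)
  have "f (x + real (Suc k)) = f ((x + real k) + 1)" by (simp add: add_ac)
  with Suc show ?case by (simp only: assms)
qed auto

lemma periodic_of_int:
  assumes "\<And>x::real. f (x + 1) = f x"
  shows "f (x + of_int k) = f x"
proof (cases "k \<ge> 0")
  case True
  thus ?thesis using periodic_of_nat[of f x "nat k"] assms by simp
next
  case False
  hence "f ((x + of_int k) + real (nat (-k))) = f (x + of_int k)"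
    by (intro periodic_of_nat assms)
  with False show ?thesis by simp
qed

context
  fixes f :: "real \<Rightarrow> real"
  assumes per: "\<And>x. f (x + 1) = f x" and int: "\<And>a b. f integrable_on {a..b}"
begin

lemma integral_periodic_int: "integral {a + of_int k..b + of_int k} f = integral {a..b} f"
  using integral_shift_real_ivl[of "a + of_int k" "of_int k" "b + of_int k" f]
  by (simp add: periodic_of_int[of f, OF per])

text \<open>The window is cut at an integer, and the piece to its right is moved back by one
  period.\<close>

lemma integral_periodic_shift: "integral {c..c + 1} f = integral {0..1} f"
proof -
  define n where "n = \<lfloor>c\<rfloor>"
  have n: "of_int n \<le> c" "c \<le> of_int n + 1" unfolding n_def by linarith+
  have "integral {c..c + 1} f = integral {c..of_int n + 1} f + integral {of_int n + 1..c + 1} f"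
    using n by (intro Henstock_Kurzweil_Integration.integral_combine[symmetric] int) auto
  also have "integral {of_int n + 1..c + 1} f = integral {of_int n..c} f"
    using integral_periodic_int[of "of_int n" 1 c] by simp
  also have "integral {c..of_int n + 1} f + integral {of_int n..c} f = integral {of_int n..of_int n + 1} f"
    using n by (subst add.commute, intro Henstock_Kurzweil_Integration.integral_combine int) auto
  also have "\<dots> = integral {0..1} f"
    using integral_periodic_int[of 0 n 1] by (simp add: add_ac)
  finally show ?thesis .
qed

lemma integral_periodic_translate: "integral {0..1} (\<lambda>x. f (x + c)) = integral {0..1} f"
  using integral_shift_real_ivl[of c c "c + 1" f] integral_periodic_shift[of c] by simp

lemma integral_periodic_nat: "integral {0..real n} f = real n * integral {0..1} f"
proof (induction n)
  case (Suc n)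
  have "integral {0..real (Suc n)} f = integral {0..real n} f + integral {real n..real n + 1} f"
    by (subst Henstock_Kurzweil_Integration.integral_combine) (auto intro!: int simp: add_ac)
  with Suc integral_periodic_shift[of "real n"] show ?case by (simp add: algebra_simps)
qed auto

lemma integral_periodic_stretch:
  assumes "n > 0"
  shows "integral {0..1} (\<lambda>x. f (real n * x)) = integral {0..1} f"
proof -
  have "(\<lambda>x. x / real n) ` {0..real n} = {0..1}"
  proof (intro equalityI subsetI)
    fix x :: real assume "x \<in> {0..1}"
    thus "x \<in> (\<lambda>x. x / real n) ` {0..real n}"
      using assms by (intro image_eqI[of _ _ "x * n"]) (auto simp: mult_left_le_one_le)
  qed (use assms in auto)
  with integral_stretch_real[of "real n" 0 "real n" f] assms show ?thesis
    by (simp add: integral_periodic_nat)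
qed

end

section \<open>The sawtooth function and its correlations\<close>

text \<open>The first periodic Bernoulli function, with value -1/2 at the integers. Its mean is 0,
  so the linear terms vanish when a product of fractional parts is expanded.\<close>

definition saw :: "real \<Rightarrow> real" where "saw x = frac x - 1 / 2"

lemma saw_add_of_int [simp]: "saw (x + of_int k) = saw x"
  by (simp add: saw_def frac_def)

lemma saw_add_1 [simp]: "saw (x + 1) = saw x"
  using saw_add_of_int[of x 1] by simp

lemma saw_add_of_nat [simp]: "saw (x + real k) = saw x"
  using saw_add_of_int[of x "int k"] by simp

lemma abs_saw_le: "\<bar>saw x\<bar> \<le> 1"
  using frac_ge_0[of x] frac_lt_1[of x] unfolding saw_def by linarith

lemma borel_measurable_saw [measurable]: "saw \<in> borel_measurable borel"
  unfolding saw_def[abs_def] frac_def by measurable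

lemma frac_of_int_plus_divide:
  assumes "b > 0" "0 \<le> t" "t < 1"
  shows "frac ((of_int m + t) / real b) = (of_int (m mod int b) + t) / real b"
proof (rule frac_unique_iff[THEN iffD2], intro conjI)
  have "m = int b * (m div int b) + m mod int b" by simp
  hence "of_int m = real b * of_int (m div int b) + of_int (m mod int b)"
    by (metis of_int_add of_int_mult of_int_of_nat_eq)
  hence "(of_int m + t) / real b - (of_int (m mod int b) + t) / real b = of_int (m div int b)"
    using assms by (simp add: field_simps)
  thus "(of_int m + t) / real b - (of_int (m mod int b) + t) / real b \<in> \<int>" by simp
  show "0 \<le> (of_int (m mod int b) + t) / real b" using assms by simp
  have "m mod int b \<le> int b - 1" using assms pos_mod_bound[of "int b" m] by linarith
  hence "of_int (m mod int b) + t < real b" using assms(3) by linarith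
  thus "(of_int (m mod int b) + t) / real b < 1" using assms by simp
qed

text \<open>Distribution relation of the sawtooth. If b y = k + t with t the fractional part, the
  fractional parts on the left are (r + t)/b with r running through all residues modulo b, because a
  is invertible. The residues add up to b(b-1)/2, which leaves t - 1/2.\<close>

lemma sum_saw_residues:
  assumes "coprime a b" "b > 0"
  shows "(\<Sum>j<b. saw (y + real a * real j / real b)) = saw (real b * y)"
proof -
  define k where "k = \<lfloor>real b * y\<rfloor>"
  define t where "t = frac (real b * y)"
  have t: "0 \<le> t" "t < 1" by (simp_all add: t_def frac_lt_1)
  define r where "r j = nat ((k + int a * int j) mod int b)" for j
  have eq: "frac (y + real a * real j / real b) = (real (r j) + t) / real b" for j
  proof -
    have "y + real a * real j / real b = (of_int (k + int a * int j) + t) / real b"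
      using assms(2) by (simp add: k_def t_def frac_def field_simps)
    also have "frac \<dots> = (of_int ((k + int a * int j) mod int b) + t) / real b"
      using assms(2) t by (rule frac_of_int_plus_divide)
    also have "of_int ((k + int a * int j) mod int b) = real (r j)"
      using assms(2) by (simp add: r_def)
    finally show ?thesis .
  qed
  have "inj_on r {..<b}"
  proof (rule inj_onI)
    fix i j assume ij: "i \<in> {..<b}" "j \<in> {..<b}" "r i = r j"
    hence "(k + int a * int i) mod int b = (k + int a * int j) mod int b"
      using assms(2) by (simp add: r_def eq_nat_nat_iff)
    hence "int b dvd (k + int a * int i) - (k + int a * int j)" by (rule mod_eq_dvd_iff[THEN iffD1])
    hence "int b dvd int a * (int i - int j)" by (simp add: algebra_simps)
    moreover have "coprime (int b) (int a)" using assms(1) by (simp add: coprime_commute)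
    ultimately have "int b dvd int i - int j" by (simp add: coprime_dvd_mult_right_iff)
    moreover have "\<bar>int i - int j\<bar> < int b" using ij by auto
    ultimately have "int i - int j = 0" using dvd_imp_le_int[of "int i - int j" "int b"] by linarith
    thus "i = j" by simp
  qed
  moreover have "r ` {..<b} \<subseteq> {..<b}" using assms(2) by (auto simp: r_def nat_less_iff)
  ultimately have "r ` {..<b} = {..<b}" by (intro endo_inj_surj) auto
  hence "(\<Sum>j<b. real (r j)) = (\<Sum>i<b. real i)"
    using sum.reindex[OF \<open>inj_on r {..<b}\<close>, of real] by simp
  also have "\<dots> = real b * (real b - 1) / 2"
    by (induction b) (auto simp: field_simps)
  finally have r_sum: "(\<Sum>j<b. real (r j)) = real b * (real b - 1) / 2" .
  have "(\<Sum>j<b. saw (y + real a * real j / real b)) =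
      ((\<Sum>j<b. real (r j)) + real b * t) / real b - real b / 2"
    unfolding saw_def eq by (simp add: sum_subtractf sum.distrib flip: sum_divide_distrib)
  also have "\<dots> = t - 1 / 2"
    unfolding r_sum using assms(2) by (simp add: field_simps)
  finally show ?thesis by (simp only: saw_def t_def)
qed

lemma integrable_saw_product:
  "(\<lambda>x. saw (c * x + d) * saw (c' * x + d')) integrable_on {a..b}"
proof (rule integrable_on_Icc_bounded_borel[where B = 1])
  have "\<bar>saw (c * x + d)\<bar> * \<bar>saw (c' * x + d')\<bar> \<le> 1 * 1" for x
    by (intro mult_mono abs_saw_le) auto
  thus "\<bar>saw (c * x + d) * saw (c' * x + d')\<bar> \<le> 1" for x by (simp add: abs_mult)
qed measurable

lemma integrable_saw_product': "(\<lambda>x. saw (c * x) * saw (c' * x)) integrable_on {a..b}"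
  using integrable_saw_product[of c 0 c' 0] by simp

lemma saw_nat_mult_periodic: "saw (real n * (x + 1)) = saw (real n * x)"
  using saw_add_of_nat[of "real n * x" n] by (simp add: algebra_simps)

text \<open>Averaging over the translations by \<open>j/b\<close> fixes \<open>saw (bx)\<close> and turns \<open>saw (ax)\<close> into \<open>saw (abx) / b\<close>.\<close>

lemma integral_saw_product_step:
  assumes "coprime a b" "b > 0"
  shows "integral {0..1} (\<lambda>x. saw (real a * x) * saw (real b * x)) =
         integral {0..1} (\<lambda>x. saw (real a * x) * saw x) / real b"
proof -
  define h where "h x = saw (real a * x) * saw (real b * x)" for x
  have h: "h (x + 1) = h x" "h integrable_on {u..v}" for x u v
    unfolding h_def by (simp_all only: saw_nat_mult_periodic integrable_saw_product')
  have shifted: "h (x + real j / real b) = saw (real a * x + real a * real j / real b) * saw (real b * x)" for x j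
  proof -
    have "real b * (x + real j / real b) = real b * x + real j" using assms(2) by (simp add: field_simps)
    moreover have "real a * (x + real j / real b) = real a * x + real a * real j / real b"
      by (simp add: distrib_left)
    ultimately show ?thesis unfolding h_def by (simp only: saw_add_of_nat)
  qed
  \<comment> \<open>Each of the b translates has the same integral over a period. After summation
    the integrand depends on b x only, so the factor b can be stretched away.\<close>
  have "real b * integral {0..1} h = (\<Sum>j<b. integral {0..1} (\<lambda>x. h (x + real j / real b)))"
    by (simp add: integral_periodic_translate[OF h])
  also have "\<dots> = integral {0..1} (\<lambda>x. \<Sum>j<b. h (x + real j / real b))"
    unfolding shifted using integrable_saw_product[where d' = 0]
    by (intro Henstock_Kurzweil_Integration.integral_sum[symmetric]) auto
  also have "(\<lambda>x. \<Sum>j<b. h (x + real j / real b)) = (\<lambda>x. saw (real a * (real b * x)) * saw (real b * x))"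
    unfolding shifted sum_distrib_right[symmetric] sum_saw_residues[OF assms] by (simp add: mult_ac)
  also have "integral {0..1} \<dots> = integral {0..1} (\<lambda>x. saw (real a * x) * saw x)"
    using assms(2) integrable_saw_product'[of "real a" 1]
    by (intro integral_periodic_stretch[where f = "\<lambda>x. saw (real a * x) * saw x"])
       (simp_all add: saw_nat_mult_periodic)
  finally show ?thesis using assms(2) by (simp add: h_def[abs_def] field_simps)
qed

lemma integral_saw_square: "integral {0..1} (\<lambda>x. saw x * saw x) = 1 / 12"
proof -
  have "((\<lambda>x. (x - 1/2) * (x - 1/2)) has_integral ((1 - 1/2) ^ 3 / 3 - (0 - 1/2) ^ 3 / 3)) {0..1::real}"
    by (rule fundamental_theorem_of_calculus)
       (auto intro!: derivative_eq_intros simp flip: has_real_derivative_iff_has_vector_derivative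
         simp: power2_eq_square)
  hence "((\<lambda>x. saw x * saw x) has_integral ((1 - 1/2) ^ 3 / 3 - (0 - 1/2) ^ 3 / 3)) {0..1::real}"
    \<comment> \<open>At x = 1 the fractional part drops to 0; this single point is
      negligible.\<close>
    by (rule has_integral_spike[of "{1}", rotated 2])
       (auto simp: saw_def frac_eq[THEN iffD2])
  thus ?thesis by (simp add: integral_unique power3_eq_cube)
qed

lemma integral_saw: "integral {0..1} saw = 0"
proof -
  have "((\<lambda>x. x - 1/2) has_integral ((1 - 1/2) ^ 2 / 2 - (0 - 1/2) ^ 2 / 2)) {0..1::real}"
    by (rule fundamental_theorem_of_calculus)
       (auto intro!: derivative_eq_intros simp flip: has_real_derivative_iff_has_vector_derivative)
  hence "(saw has_integral ((1 - 1/2) ^ 2 / 2 - (0 - 1/2) ^ 2 / 2)) {0..1::real}"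
    by (rule has_integral_spike[of "{1}", rotated 2])
       (auto simp: saw_def frac_eq[THEN iffD2])
  thus ?thesis by (simp add: integral_unique power2_eq_square)
qed

text \<open>Stretching by the gcd reduces to coprime a and b with a b = n m / gcd^2. The averaging
  step removes b, then, with the frequencies 1 and a, it removes a; what remains is the mean square
  1/12.\<close>

lemma integral_saw_product:
  assumes "n > 0" "m > 0"
  shows "integral {0..1} (\<lambda>x. saw (real n * x) * saw (real m * x)) =
         (real (gcd n m))\<^sup>2 / (12 * real n * real m)"
proof -
  define g where "g = gcd n m"
  obtain a b where ab: "n = g * a" "m = g * b" "coprime a b"
    using gcd_coprime_exists[of n m] assms unfolding g_def by (metis gcd_eq_0_iff mult.commute neq0_conv)
  have pos: "g > 0" "a > 0" "b > 0" using assms ab by (auto intro: Nat.gr0I)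
  have "integral {0..1} (\<lambda>x. saw (real n * x) * saw (real m * x)) =
        integral {0..1} (\<lambda>x. saw (real a * (real g * x)) * saw (real b * (real g * x)))"
    by (simp add: ab mult_ac)
  also have "\<dots> = integral {0..1} (\<lambda>x. saw (real a * x) * saw (real b * x))"
    using pos by (intro integral_periodic_stretch[where f = "\<lambda>x. saw (real a * x) * saw (real b * x)"])
      (simp_all add: saw_nat_mult_periodic integrable_saw_product')
  also have "\<dots> = integral {0..1} (\<lambda>x. saw (real a * x) * saw x) / real b"
    by (rule integral_saw_product_step) (use ab pos in auto)
  also have "integral {0..1} (\<lambda>x. saw (real a * x) * saw x) =
             integral {0..1} (\<lambda>x. saw (real 1 * x) * saw (real a * x))"
    by (simp add: mult.commute)
  also have "\<dots> = integral {0..1} (\<lambda>x. saw (real 1 * x) * saw x) / real a"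
    by (rule integral_saw_product_step) (use pos in auto)
  also have "\<dots> / real b = 1 / (12 * real a * real b)"
    by (simp add: integral_saw_square)
  also have "\<dots> = (real g)\<^sup>2 / (12 * real n * real m)"
    using pos by (simp add: ab power2_eq_square)
  finally show ?thesis by (simp add: g_def)
qed

text \<open>X is an integer, so the mean runs over whole periods. Expanding both factors as 1/2 +
  \<open>saw\<close> leaves the constant 1/4 and the sawtooth correlation.\<close>

lemma mean_upto_frac_product:
  assumes "X > 0" "n > 0" "m > 0"
  shows "mean_upto X (\<lambda>x. frac (real n * x) * frac (real m * x)) =
         1 / 4 + (real (gcd n m))\<^sup>2 / (12 * real n * real m)"
proof -
  define f where "f x = frac (real n * x) * frac (real m * x)" for x
  have f_eq: "f x = saw (real n * x) * saw (real m * x) + (saw (real n * x) / 2 + (saw (real m * x) / 2 + 1 / 4))" for x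
    by (simp add: f_def saw_def field_simps)
  have int_saw: "(\<lambda>x. saw (c * x)) integrable_on {a..b}" for a b c
    by (rule integrable_on_Icc_bounded_borel[where B = 1]) (auto simp: abs_saw_le)
  have int: "f integrable_on {a..b}" for a b
    unfolding f_eq[abs_def]
    by (intro integrable_add integrable_saw_product' integrable_on_divide int_saw integrable_const_ivl)
  have per: "f (x + 1) = f x" for x unfolding f_eq by (simp only: saw_nat_mult_periodic)
  have saw0: "integral {0..1} (\<lambda>x. saw (real k * x)) = 0" if "k > 0" for k
    using that int_saw[of 1] by (subst integral_periodic_stretch) (auto simp: integral_saw)
  have "integral {0..1} f = integral {0..1} (\<lambda>x. saw (real n * x) * saw (real m * x)) +
      (integral {0..1} (\<lambda>x. saw (real n * x)) / 2 + (integral {0..1} (\<lambda>x. saw (real m * x)) / 2 + 1 / 4))"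
    unfolding f_eq
    by (subst Henstock_Kurzweil_Integration.integral_add integral_divide;
        (intro integrable_add integrable_saw_product' integrable_on_divide int_saw integrable_const_ivl)?)+ simp
  also have "\<dots> = 1 / 4 + (real (gcd n m))\<^sup>2 / (12 * real n * real m)"
    using assms by (simp add: saw0 integral_saw_product)
  finally show ?thesis
    using assms(1) integral_periodic_nat[OF per int, of X] by (simp add: mean_upto_def f_def[abs_def])
qed

section \<open>The off-diagonal sum\<close>

lemma offdiag_sum_eq:
  assumes "X > 0"
  shows "offdiag_sum X N = (\<Sum>n=1..N. moebius n / real n)\<^sup>2 / 4
           + (\<Sum>(n, m)\<in>{1..N} \<times> {1..N}. gcd_term n m) / 12
           - (\<Sum>n=1..N. (moebius n)\<^sup>2 / (real n)\<^sup>2) / 3"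
proof -
  define c where "c = (\<lambda>(n, m). moebius n * moebius m / (real n * real m) *
        mean_upto X (\<lambda>x. frac (real n * x) * frac (real m * x)))"
  define A where "A = {1..N} \<times> {1..N}"
  define D where "D = (\<lambda>n. (n, n)) ` {1..N}"
  have c_eq: "c (n, m) = (moebius n / real n) * (moebius m / real m) / 4 + gcd_term n m / 12"
    if "n > 0" "m > 0" for n m
    unfolding c_def gcd_term_def prod.case mean_upto_frac_product[OF assms that]
    using that by (simp add: field_simps power2_eq_square)
  have "{(n, m). n \<in> {1..N} \<and> m \<in> {1..N} \<and> n \<noteq> m} = A - D"
    by (auto simp: A_def D_def)
  hence "offdiag_sum X N = sum c (A - D)"
    unfolding offdiag_sum_def c_def by simp
  also have "\<dots> = sum c A - sum c D"
    by (rule sum_diff) (auto simp: A_def D_def)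
  also have "sum c A = (\<Sum>(n, m)\<in>A. (moebius n / real n) * (moebius m / real m) / 4 + gcd_term n m / 12)"
    by (rule sum.cong) (auto simp: A_def c_eq)
  also have "\<dots> = (\<Sum>(n, m)\<in>A. (moebius n / real n) * (moebius m / real m)) / 4
                  + (\<Sum>(n, m)\<in>A. gcd_term n m) / 12"
    by (simp add: case_prod_unfold sum.distrib sum_divide_distrib)
  also have "(\<Sum>(n, m)\<in>A. (moebius n / real n) * (moebius m / real m)) = (\<Sum>n=1..N. moebius n / real n)\<^sup>2"
    unfolding A_def power2_eq_square sum_product sum.cartesian_product ..
  also have "sum c D = (\<Sum>n=1..N. c (n, n))"
    unfolding D_def by (subst sum.reindex) (auto simp: inj_on_def)
  \<comment> \<open>On the diagonal gcd(n,n) = n, so the correlation is 1/4 + 1/12 = 1/3.\<close>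
  also have "\<dots> = (\<Sum>n=1..N. (moebius n)\<^sup>2 / (real n)\<^sup>2 / 3)"
    by (rule sum.cong) (auto simp: c_eq gcd_term_def power2_eq_square field_simps)
  also have "\<dots> = (\<Sum>n=1..N. (moebius n)\<^sup>2 / (real n)\<^sup>2) / 3"
    by (simp only: sum_divide_distrib)
  finally show ?thesis by (simp only: A_def)
qed

theorem offdiag_sum_tendsto:
  assumes "X > 0"
  shows "offdiag_sum X \<longlonglongrightarrow> - (9 / (2 * pi\<^sup>2))"
proof -
  have pairs: "(\<lambda>N. \<Sum>(n, m)\<in>{1..N} \<times> {1..N}. gcd_term n m) \<longlonglongrightarrow> 6 / pi\<^sup>2"
  proof (rule has_sum_tendsto_exhaustion[OF gcd_term_has_sum])
    fix p :: "nat \<times> nat" assume p: "p \<in> {1..} \<times> {1..}"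
    show "eventually (\<lambda>N. p \<in> {1..N} \<times> {1..N}) sequentially"
      using eventually_ge_at_top[of "max (fst p) (snd p)"] by eventually_elim (use p in auto)
  qed auto
  have diagonal: "(\<lambda>N. \<Sum>n=1..N. (moebius n)\<^sup>2 / (real n)\<^sup>2) \<longlonglongrightarrow> 15 / pi\<^sup>2"
  proof (rule has_sum_tendsto_exhaustion[OF moebius_square_over_square_has_sum])
    fix n :: nat assume n: "n \<in> {1..}"
    show "eventually (\<lambda>N. n \<in> {1..N}) sequentially"
      using eventually_ge_at_top[of n] by eventually_elim (use n in auto)
  qed auto
  have "(\<lambda>N. (\<Sum>n=1..N. moebius n / real n)\<^sup>2 / 4
           + (\<Sum>(n, m)\<in>{1..N} \<times> {1..N}. gcd_term n m) / 12
           - (\<Sum>n=1..N. (moebius n)\<^sup>2 / (real n)\<^sup>2) / 3)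
        \<longlonglongrightarrow> 0\<^sup>2 / 4 + 6 / pi\<^sup>2 / 12 - 15 / pi\<^sup>2 / 3"
    by (intro tendsto_intros moebius_over_n_tendsto_0 pairs diagonal) auto
  moreover have "0\<^sup>2 / 4 + 6 / pi\<^sup>2 / 12 - 15 / pi\<^sup>2 / 3 = - (9 / (2 * pi\<^sup>2))"
    by (simp add: field_simps)
  ultimately show ?thesis
    unfolding offdiag_sum_eq[OF assms, abs_def] by simp
qed

theorem theorem1:
  shows "\<exists>C::real. \<forall>X::nat. X \<ge> 1 \<longrightarrow>
           (\<exists>S::real. (\<lambda>N. offdiag_sum X N) \<longlonglongrightarrow> S \<and>
              \<bar>S - (- (9 / (2 * pi\<^sup>2)))\<bar> \<le> C / real X)"
proof (rule exI[of _ 0], intro allI impI)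
  fix X :: nat assume "X \<ge> 1"
  hence "offdiag_sum X \<longlonglongrightarrow> - (9 / (2 * pi\<^sup>2))" by (intro offdiag_sum_tendsto) auto
  thus "\<exists>S::real. (\<lambda>N. offdiag_sum X N) \<longlonglongrightarrow> S \<and> \<bar>S - (- (9 / (2 * pi\<^sup>2)))\<bar> \<le> 0 / real X"
    by (intro exI[of _ "- (9 / (2 * pi\<^sup>2))"]) simp
qed

end
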